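(* Let $\eta_j=c_0j^{-\alpha}$, $j=1,2,\ldots$, with $\alpha\in(0,1)$ and $c_0\max_i\|a_i\|^2\le 1$. Suppose the source condition holds: there exists some $w\in\mathbb{R}^m$ such that $x^\dag-x_1=B^pw$, with $p\ge0$. Then there holds $$\mathbb{E}[\|x_{k+1}^\delta-x^\dag\|^2]\le c\,k^{-\min(2\alpha,\ \min(1,2p)(1-\alpha))}\ln^2k+c'k^{1-\alpha}\bar\delta^2+c''\delta^2,$$ where the constants $c,c'$ and $c''$ depend on $\alpha,p,\|w\|,\|Ax_1-y^\delta\|$ and $\|A\|$ (and are independent of the iteration index $k$ and the noise level $\delta$).
   Context: Let $A\in\mathbb{R}^{n\times m}$, with $i$th row written as a column vector $a_i\in\mathbb{R}^m$, let $x_1\in\mathbb{R}^m$ be a fixed (deterministic) initial guess, and let $y^\dag\in\mathbb{R}^n$ be exact data in the range of $A$. The reference solution is the minimum norm solution relative to $x_1$: $x^\dag=\arg\min\{\|x-x_1\|: x\in\mathbb{R}^m,\ Ax=y^\dag\}$. Noisy data are $y^\delta=y^\dag+\xi$ with noise level $\delta=\|\xi\|$, and $\bar\delta=n^{-1/2}\delta$; $\xi$ (a realization of an i.i.d. mean-zero Gaussian vector) is fixed, and all expectations are only over the random indices below. Stochastic gradient descent (SGD): $x_1^\delta=x_1$ and $$x_{k+1}^\delta=x_k^\delta-\eta_k\big((a_{i_k},x_k^\delta)-y^\delta_{i_k}\big)a_{i_k},\quad k=1,2,\ldots,$$ where the indices $i_k$ are drawn i.i.d. uniformly from $\{1,\ldots,n\}$,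 $\eta_k>0$ are the step sizes, and $(\cdot,\cdot)$ is the Euclidean inner product. $B=n^{-1}A^tA\in\mathbb{R}^{m\times m}$, and $B^p$ is the usual fractional power defined via spectral decomposition. $\|\cdot\|$ is the Euclidean norm for vectors and the spectral norm for matrices.
   Formalization: The bound is stated for k ≥ 2 (at k = 1 the factor ln²k is 0 and the claim fails for δ = 0), and the constants c, c', c'' may also depend on c_0 (independence of c_0 fails as c_0 → 0). *)

theory Defs
  imports "HOL-Probability.Probability" "Jordan_Normal_Form.Matrix"
begin

text \<open>
  Vectors and matrices are those of \<^theory>\<open>Jordan_Normal_Form.Matrix\<close>, whose dimensions are
  values rather than types, so that the dimensions can be quantified after the constants of an
  estimate. Indices of rows and components start at \<open>0\<close>.
\<close>

definition vnorm :: "real Matrix.vec \<Rightarrow> real" where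
  "vnorm v = sqrt (scalar_prod v v)"

definition spectral_norm :: "real Matrix.mat \<Rightarrow> real" where
  "spectral_norm A = (SUP x\<in>{x \<in> carrier_vec (dim_col A). vnorm x \<le> 1}. vnorm (A *\<^sub>v x))"

text \<open>Real powers with \<open>t\<^sup>0 = 1\<close> also for \<open>t = 0\<close> (the library has \<open>0 powr 0 = 0\<close>).\<close>

definition rpow :: "real \<Rightarrow> real \<Rightarrow> real" where
  "rpow t p = (if p = 0 then 1 else t powr p)"

text \<open>
  For symmetric positive semidefinite \<open>B = Q diag(d) Q\<^sup>T\<close> with orthogonal \<open>Q\<close>, the power is
  \<open>B\<^sup>p = Q diag(d\<^sup>p) Q\<^sup>T\<close>; it does not depend on the choice of the decomposition. The library
  predicate \<open>orthogonal_mat\<close> does not normalise the columns, hence the equation for \<open>Q\<close>.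
\<close>

definition mat_fpow :: "real Matrix.mat \<Rightarrow> real \<Rightarrow> real Matrix.mat" where
  "mat_fpow B p = (THE C. \<exists>Q d.
     Q \<in> carrier_mat (dim_row B) (dim_row B) \<and>
     transpose_mat Q * Q = 1\<^sub>m (dim_row B) \<and>
     B = Q * mat_diag (dim_row B) d * transpose_mat Q \<and>
     C = Q * mat_diag (dim_row B) (\<lambda>i. rpow (d i) p) * transpose_mat Q)"

definition normal_mat :: "real Matrix.mat \<Rightarrow> real Matrix.mat" where
  "normal_mat A = (1 / real (dim_row A)) \<cdot>\<^sub>m (transpose_mat A * A)"

text \<open>
  \<open>sgd A y \<eta> x\<^sub>1 i k\<close> is the iterate \<open>x\<^sub>k\<close> for data \<open>y\<close>, step sizes \<open>\<eta>\<close> and row indices \<open>i\<close>. The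
  iteration starts at \<open>k = 1\<close>; the value at \<open>k = 0\<close> is a dummy, and \<open>\<eta> 0\<close>, \<open>i 0\<close> are never used.
\<close>

fun sgd :: "real Matrix.mat \<Rightarrow> real Matrix.vec \<Rightarrow> (nat \<Rightarrow> real) \<Rightarrow> real Matrix.vec \<Rightarrow>
    (nat \<Rightarrow> nat) \<Rightarrow> nat \<Rightarrow> real Matrix.vec" where
  "sgd A y \<eta> x1 i 0 = x1"
| "sgd A y \<eta> x1 i (Suc 0) = x1"
| "sgd A y \<eta> x1 i (Suc (Suc k)) =
     (let x = sgd A y \<eta> x1 i (Suc k); l = i (Suc k) in
      x - (\<eta> (Suc k) * (scalar_prod (Matrix.row A l) x - Matrix.vec_index y l))
            \<cdot>\<^sub>v Matrix.row A l)"

definition iid_uniform :: "'a measure \<Rightarrow> nat \<Rightarrow> (nat \<Rightarrow> 'a \<Rightarrow> nat) \<Rightarrow> bool" where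
  "iid_uniform M n I \<longleftrightarrow>
     prob_space M \<and>
     prob_space.indep_vars M (\<lambda>_. count_space UNIV) I {1..} \<and>
     (\<forall>j\<ge>1. distr M (count_space UNIV) (I j) = measure_pmf (pmf_of_set {..<n}))"

definition min_norm_solution ::
    "real Matrix.mat \<Rightarrow> real Matrix.vec \<Rightarrow> real Matrix.vec \<Rightarrow> real Matrix.vec \<Rightarrow> bool" where
  "min_norm_solution A y x1 x \<longleftrightarrow>
     is_arg_min (\<lambda>z. vnorm (z - x1)) (\<lambda>z. z \<in> carrier_vec (dim_col A) \<and> A *\<^sub>v z = y) x"

end

theory Submission
  imports Defs "Jordan_Normal_Form.Spectral_Radius"
begin

text \<open>
  By linearity the error is the sum of the error of the noise-free iteration and of an iteration
  started at \<open>0\<close> and driven by the noise. One step of the latter increases the squared norm by at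
  most \<open>\<eta>\<^sub>k \<xi>\<^sub>i\<^sup>2\<close>, which yields the term \<open>k\<^bsup>1-\<alpha>\<^esup> \<delta>bar\<^sup>2\<close>; no further noise term is needed.

  Let \<open>E\<^sub>k\<close> be the mean squared error of the noise-free iteration after \<open>k\<close> steps and \<open>F\<^sub>k\<close> the mean of
  \<open>(B u\<^sub>k, u\<^sub>k)\<close>. Then \<open>E\<^sub>k\<close> decreases by at least \<open>\<eta>\<^sub>k F\<^sub>k\<close> per step, and unrolling the iteration from
  the end bounds \<open>E\<^sub>k\<close> by the bias, which is of order \<open>k\<^bsup>-q(1-\<alpha>)\<^esup>\<close> with \<open>q = min 1 (2p)\<close>, plus the sum
  over \<open>j \<le> k\<close> of \<open>\<eta>\<^sub>j\<^sup>2 n \<phi>\<^sub>j F\<^sub>j\<close>, where \<open>\<phi>\<^sub>j\<close> bounds \<open>\<lambda> \<Prod>\<^sub>i\<^sub>>\<^sub>j (1 - \<eta>\<^sub>i \<lambda>)\<^sup>2\<close> on the spectrum of \<open>B\<close>. For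
  \<open>j \<le> k/2\<close> the dissipation bound gives a contribution \<open>k\<^bsup>\<alpha>-1\<^esup> n E\<^sub>0\<close> with \<open>E\<^sub>0\<close> of order \<open>n\<^bsup>-q\<^esup>\<close>; this is
  at most \<open>k\<^bsup>-q(1-\<alpha>)\<^esup>\<close> when \<open>n \<le> k\<^bsup>1-\<alpha>\<^esup>\<close>, and otherwise already \<open>E\<^sub>k \<le> E\<^sub>0\<close> suffices. For \<open>j > k/2\<close> the
  inequality \<open>n F\<^sub>j \<le> \<parallel>A\<parallel>\<^sup>2 E\<^sub>j\<close> gives a contribution \<open>k\<^bsup>-\<alpha>\<^esup> ln k E\<^bsub>k/2\<^esub>\<close>. Using this recursion twice,
  starting from \<open>E\<^bsub>k/4\<^esub> \<le> E\<^sub>0\<close>, produces \<open>k\<^bsup>-q(1-\<alpha>)\<^esup> + k\<^bsup>-2\<alpha>\<^esup> ln\<^sup>2 k\<close> up to constants.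
\<close>

unbundle no vec_syntax

section \<open>Iterations in an eigenbasis\<close>

definition path_mean :: "nat \<Rightarrow> nat \<Rightarrow> ((nat \<Rightarrow> nat) \<Rightarrow> real) \<Rightarrow> real" where
  "path_mean n k F = (\<Sum>f\<in>PiE {1..k} (\<lambda>_. {..<n}). F f) / real n ^ k"

text \<open>For an empty domain \<open>PiE\<close> contains only the function that is
  \<open>undefined\<close> everywhere.\<close>

lemma path_mean_0 [simp]: "path_mean n 0 F = F (\<lambda>_. undefined)"
  by (simp add: path_mean_def)

text \<open>The tower property: the last index is averaged out first, with the earlier ones held
  fixed. This turns one-step estimates into recursions for means.\<close>

lemma path_mean_Suc:
  "path_mean n (Suc k) F = path_mean n k (\<lambda>f. (\<Sum>i<n. F (f(Suc k := i))) / real n)"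
proof -
  have ins: "{1..Suc k} = insert (Suc k) {1..k}"
    by auto
  have "(\<Sum>f\<in>PiE {1..Suc k} (\<lambda>_. {..<n}). F f)
      = (\<Sum>f\<in>(\<lambda>(y, g). g(Suc k := y)) ` ({..<n} \<times> PiE {1..k} (\<lambda>_. {..<n})). F f)"
    unfolding ins PiE_insert_eq ..
  also have "\<dots> = (\<Sum>(i, f)\<in>{..<n} \<times> PiE {1..k} (\<lambda>_. {..<n}). F (f(Suc k := i)))"
    by (subst sum.reindex) (auto intro!: inj_combinator sum.cong)
  also have "\<dots> = (\<Sum>f\<in>PiE {1..k} (\<lambda>_. {..<n}). \<Sum>i<n. F (f(Suc k := i)))"
    unfolding sum.cartesian_product[symmetric] by (rule sum.swap)
  finally show ?thesis
    by (simp add: path_mean_def sum_divide_distrib mult.commute)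
qed

lemma path_mean_mono:
  assumes "\<And>f. (\<And>j. j \<in> {1..k} \<Longrightarrow> f j < n) \<Longrightarrow> F f \<le> G f"
  shows "path_mean n k F \<le> path_mean n k G"
  unfolding path_mean_def
  by (intro divide_right_mono sum_mono assms) auto

lemma path_mean_add: "path_mean n k (\<lambda>f. F f + G f) = path_mean n k F + path_mean n k G"
  by (simp add: path_mean_def sum.distrib add_divide_distrib)

lemma path_mean_cmult: "path_mean n k (\<lambda>f. c * F f) = c * path_mean n k F"
  by (simp add: path_mean_def sum_distrib_left)

lemma path_mean_const: "0 < n \<Longrightarrow> path_mean n k (\<lambda>_. c) = c"
  by (simp add: path_mean_def card_PiE)

lemma path_mean_nonneg: "(\<And>f. 0 \<le> F f) \<Longrightarrow> 0 \<le> path_mean n k F"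
  by (simp add: path_mean_def sum_nonneg)

text \<open>
  \<open>b i l\<close> is the \<open>l\<close>-th coordinate of the \<open>i\<close>-th row of the matrix in an orthonormal eigenbasis of
  the normalised normal matrix, whose eigenvalues are \<open>lam l\<close>.
\<close>

locale gram_system =
  fixes n m :: nat and b :: "nat \<Rightarrow> nat \<Rightarrow> real" and lam :: "nat \<Rightarrow> real" and c0 :: real
  assumes n_pos: "0 < n" and c0_pos: "0 < c0"
    and gram: "\<And>l l'. l < m \<Longrightarrow> l' < m \<Longrightarrow>
      (\<Sum>i<n. b i l * b i l') = (if l = l' then real n * lam l else 0)"
    and row_bound: "\<And>i. i < n \<Longrightarrow> c0 * (\<Sum>l<m. (b i l)\<^sup>2) \<le> 1"
begin

section \<open>The iteration in coordinates and its linear structure\<close>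

definition row_prod :: "nat \<Rightarrow> (nat \<Rightarrow> real) \<Rightarrow> real" where
  "row_prod i x = (\<Sum>l<m. b i l * x l)"

definition sgd_step :: "real \<Rightarrow> (nat \<Rightarrow> real) \<Rightarrow> nat \<Rightarrow> (nat \<Rightarrow> real) \<Rightarrow> nat \<Rightarrow> real" where
  "sgd_step h \<xi> i x l = x l - h * (row_prod i x - \<xi> i) * b i l"

primrec iter :: "(nat \<Rightarrow> real) \<Rightarrow> (nat \<Rightarrow> real) \<Rightarrow> (nat \<Rightarrow> real) \<Rightarrow> (nat \<Rightarrow> nat) \<Rightarrow> nat \<Rightarrow> nat \<Rightarrow> real"
  where
    "iter \<eta> \<xi> z f 0 = z"
  | "iter \<eta> \<xi> z f (Suc k) = sgd_step (\<eta> (Suc k)) \<xi> (f (Suc k)) (iter \<eta> \<xi> z f k)"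

lemma iter_cong:
  "(\<And>j. j \<in> {1..k} \<Longrightarrow> f j = g j) \<Longrightarrow> iter \<eta> \<xi> z f k = iter \<eta> \<xi> z g k"
  by (induction k) auto

lemma path_mean_iter_Suc:
  "path_mean n (Suc k) (\<lambda>f. g (iter \<eta> \<xi> z f (Suc k)))
    = path_mean n k (\<lambda>f. (\<Sum>i<n. g (sgd_step (\<eta> (Suc k)) \<xi> i (iter \<eta> \<xi> z f k))) / real n)"
proof -
  have "iter \<eta> \<xi> z (f(Suc k := i)) k = iter \<eta> \<xi> z f k" for f i
    by (rule iter_cong) auto
  then show ?thesis
    by (simp add: path_mean_Suc)
qed

lemma row_prod_add: "row_prod i (\<lambda>l. x l + y l) = row_prod i x + row_prod i y"
  by (simp add: row_prod_def distrib_left sum.distrib)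

text \<open>The step is jointly linear in iterate and noise. Both parts follow the same index path,
  so the splitting is pointwise and precedes averaging.\<close>

lemma iter_decompose:
  "iter \<eta> \<xi> z f k = (\<lambda>l. iter \<eta> (\<lambda>_. 0) z f k l + iter \<eta> \<xi> (\<lambda>_. 0) f k l)"
proof (induction k)
  case (Suc k)
  show ?case
    by (subst iter.simps, subst Suc)
      (simp add: sgd_step_def fun_eq_iff row_prod_add algebra_simps)
qed simp

lemma lam_nonneg: "l < m \<Longrightarrow> 0 \<le> lam l"
  using gram[of l l] n_pos sum_nonneg[of "{..<n}" "\<lambda>i. b i l * b i l"]
  by (auto simp: zero_le_mult_iff)

text \<open>An eigenvalue is the mean over the rows of their squared \<open>l\<close>-th
  coordinates, each of which is at most \<open>1 / c0\<close> by \<open>row_bound\<close>.\<close>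

lemma c0_lam_le: assumes l: "l < m" shows "c0 * lam l \<le> 1"
proof -
  have "real n * (c0 * lam l) = (\<Sum>i<n. c0 * (b i l)\<^sup>2)"
    using gram[OF l l] by (simp add: sum_distrib_left[symmetric] power2_eq_square)
  also have "\<dots> \<le> (\<Sum>i<n. 1)"
  proof (rule sum_mono)
    fix i assume i: "i \<in> {..<n}"
    have "(b i l)\<^sup>2 \<le> (\<Sum>l<m. (b i l)\<^sup>2)"
      using l by (intro member_le_sum) auto
    then have "c0 * (b i l)\<^sup>2 \<le> c0 * (\<Sum>l<m. (b i l)\<^sup>2)"
      using c0_pos by simp
    then show "c0 * (b i l)\<^sup>2 \<le> 1"
      using row_bound[of i] i by simp
  qed
  finally show ?thesis
    using n_pos by simp
qed

lemma sum_row_prod_coord: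
  assumes l: "l < m"
  shows "(\<Sum>i<n. row_prod i x * b i l) = real n * lam l * x l"
proof -
  have "(\<Sum>i<n. row_prod i x * b i l) = (\<Sum>l'<m. x l' * (\<Sum>i<n. b i l' * b i l))"
    unfolding row_prod_def sum_distrib_left sum_distrib_right
    by (subst sum.swap) (simp add: mult_ac)
  also have "\<dots> = (\<Sum>l'<m. if l' = l then real n * lam l * x l else 0)"
    by (intro sum.cong refl) (use gram l in auto)
  finally show ?thesis
    using l by simp
qed

lemma sum_row_prod_sq: "(\<Sum>i<n. (row_prod i x)\<^sup>2) = real n * (\<Sum>l<m. lam l * (x l)\<^sup>2)"
proof -
  have "(\<Sum>i<n. (row_prod i x)\<^sup>2) = (\<Sum>i<n. \<Sum>l<m. row_prod i x * b i l * x l)"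
    by (intro sum.cong refl)
      (subst power2_eq_square, subst (2) row_prod_def, simp add: sum_distrib_left mult_ac)
  also have "\<dots> = (\<Sum>l<m. (\<Sum>i<n. row_prod i x * b i l) * x l)"
    by (subst sum.swap) (simp add: sum_distrib_right)
  also have "\<dots> = (\<Sum>l<m. real n * lam l * x l * x l)"
    by (intro sum.cong refl) (simp add: sum_row_prod_coord)
  finally show ?thesis
    by (simp add: sum_distrib_left power2_eq_square mult_ac)
qed

text \<open>This is \<open>a\<^sub>i a\<^sub>i\<^sup>T \<le> A\<^sup>T A\<close>, conjugated with the square root of the weight.\<close>

lemma weighted_row_le:
  assumes i: "i < n" and \<phi>: "0 \<le> \<phi>"
    and P: "\<And>l. l < m \<Longrightarrow> 0 \<le> P l" "\<And>l. l < m \<Longrightarrow> lam l * P l \<le> \<phi>"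
  shows "(\<Sum>l<m. P l * (b i l)\<^sup>2) \<le> real n * \<phi>"
proof -
  define S where "S = (\<Sum>l<m. P l * (b i l)\<^sup>2)"
  have S0: "0 \<le> S"
    unfolding S_def by (intro sum_nonneg) (use P in auto)
  \<comment> \<open>\<open>S\<close> is entry \<open>i\<close> of A P a_i, so S^2 is at most |A P
    a_i|^2 = n (B P a_i, P a_i). The bound on \<open>lam l * P l\<close> turns this into n \<phi> S,
    and one factor S cancels.\<close>
  have "S = row_prod i (\<lambda>l. P l * b i l)"
    by (simp add: S_def row_prod_def power2_eq_square mult_ac)
  then have "S * S = (row_prod i (\<lambda>l. P l * b i l))\<^sup>2"
    by (simp add: power2_eq_square)
  also have "\<dots> \<le> (\<Sum>i'<n. (row_prod i' (\<lambda>l. P l * b i l))\<^sup>2)"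
    using i by (intro member_le_sum[of i "{..<n}" "\<lambda>i'. (row_prod i' (\<lambda>l. P l * b i l))\<^sup>2"]) auto
  also have "\<dots> = real n * (\<Sum>l<m. (lam l * P l) * (P l * (b i l)\<^sup>2))"
    unfolding sum_row_prod_sq by (simp add: power2_eq_square mult_ac)
  also have "\<dots> \<le> real n * (\<Sum>l<m. \<phi> * (P l * (b i l)\<^sup>2))"
    by (intro mult_left_mono sum_mono mult_right_mono) (use P in auto)
  also have "\<dots> = real n * \<phi> * S"
    by (simp add: S_def sum_distrib_left mult_ac)
  finally have *: "S * S \<le> real n * \<phi> * S" .
  show ?thesis
  proof (cases "S = 0")
    case False
    then show ?thesis
      using * S0 by (simp add: S_def)
  next
    case True
    then show ?thesis
      using \<phi> S_def by simp
  qed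
qed

section \<open>One-step estimates\<close>

lemma step_norm_le:
  assumes h: "0 \<le> h" "h \<le> c0" and i: "i < n"
  shows "(\<Sum>l<m. (sgd_step h \<xi> i x l)\<^sup>2)
    \<le> (\<Sum>l<m. (x l)\<^sup>2) - h * (row_prod i x - \<xi> i)\<^sup>2 - 2 * h * (row_prod i x - \<xi> i) * \<xi> i"
proof -
  define t where "t = row_prod i x - \<xi> i"
  have "(\<Sum>l<m. (sgd_step h \<xi> i x l)\<^sup>2)
      = (\<Sum>l<m. (x l)\<^sup>2 - 2 * h * t * (b i l * x l) + h * t\<^sup>2 * (h * (b i l)\<^sup>2))"
    by (intro sum.cong refl) (simp add: sgd_step_def t_def power2_eq_square algebra_simps)
  also have "\<dots> = (\<Sum>l<m. (x l)\<^sup>2) - 2 * h * t * row_prod i x + h * t\<^sup>2 * (h * (\<Sum>l<m. (b i l)\<^sup>2))"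
    by (simp add: sum.distrib sum_subtractf sum_distrib_left row_prod_def)
  \<comment> \<open>Since h |a_i|^2 <= 1, the quadratic term costs at most h t^2, half of the gain 2
    h t^2 contained in the linear term.\<close>
  also have "\<dots> \<le> (\<Sum>l<m. (x l)\<^sup>2) - 2 * h * t * row_prod i x + h * t\<^sup>2 * 1"
  proof -
    have "h * (\<Sum>l<m. (b i l)\<^sup>2) \<le> c0 * (\<Sum>l<m. (b i l)\<^sup>2)"
      using h by (intro mult_right_mono sum_nonneg) auto
    then have "h * (\<Sum>l<m. (b i l)\<^sup>2) \<le> 1"
      using row_bound[OF i] by simp
    then show ?thesis
      using h by (intro add_left_mono mult_left_mono) auto
  qed
  also have "\<dots> = (\<Sum>l<m. (x l)\<^sup>2) - h * t\<^sup>2 - 2 * h * t * \<xi> i"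
    by (simp add: t_def power2_eq_square algebra_simps)
  finally show ?thesis
    by (simp add: t_def)
qed

lemma step_norm_noise_le:
  assumes h: "0 \<le> h" "h \<le> c0" and i: "i < n"
  shows "(\<Sum>l<m. (sgd_step h \<xi> i x l)\<^sup>2) \<le> (\<Sum>l<m. (x l)\<^sup>2) + h * (\<xi> i)\<^sup>2"
proof -
  \<comment> \<open>Completing the square bounds the two residual terms of
    \<open>step_norm_le\<close> by h times the squared noise.\<close>
  have "0 \<le> h * (row_prod i x - \<xi> i + \<xi> i)\<^sup>2"
    using h by simp
  also have "\<dots> = h * (row_prod i x - \<xi> i)\<^sup>2 + 2 * h * (row_prod i x - \<xi> i) * \<xi> i + h * (\<xi> i)\<^sup>2"
    by (simp add: power2_eq_square algebra_simps)
  finally show ?thesis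
    using step_norm_le[OF assms, of \<xi> x] by linarith
qed

lemma mean_step_norm_le:
  assumes h: "0 \<le> h" "h \<le> c0"
  shows "(\<Sum>i<n. \<Sum>l<m. (sgd_step h (\<lambda>_. 0) i x l)\<^sup>2) / real n
    \<le> (\<Sum>l<m. (x l)\<^sup>2) - h * (\<Sum>l<m. lam l * (x l)\<^sup>2)"
proof -
  have "(\<Sum>i<n. \<Sum>l<m. (sgd_step h (\<lambda>_. 0) i x l)\<^sup>2)
      \<le> (\<Sum>i<n. (\<Sum>l<m. (x l)\<^sup>2) - h * (row_prod i x)\<^sup>2)"
    by (intro sum_mono) (use step_norm_le[OF h, of _ "\<lambda>_. 0" x] in auto)
  also have "\<dots> = real n * ((\<Sum>l<m. (x l)\<^sup>2) - h * (\<Sum>l<m. lam l * (x l)\<^sup>2))"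
    by (simp add: sum_subtractf sum_distrib_left[symmetric] sum_row_prod_sq algebra_simps)
  finally show ?thesis
    using n_pos by (simp add: field_simps)
qed

text \<open>A bias-variance splitting: the mean step contracts coordinate \<open>l\<close> by 1 - h
  \<open>lam l\<close>, and the second moment of the random increment is controlled by
  \<open>weighted_row_le\<close> and \<open>sum_row_prod_sq\<close>.\<close>

lemma mean_step_weighted_le:
  assumes P: "0 \<le> \<phi>" "\<And>l. l < m \<Longrightarrow> 0 \<le> P l" "\<And>l. l < m \<Longrightarrow> lam l * P l \<le> \<phi>"
  shows "(\<Sum>i<n. \<Sum>l<m. P l * (sgd_step h (\<lambda>_. 0) i x l)\<^sup>2) / real n
    \<le> (\<Sum>l<m. P l * (1 - h * lam l)\<^sup>2 * (x l)\<^sup>2)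
      + h\<^sup>2 * (real n * \<phi>) * (\<Sum>l<m. lam l * (x l)\<^sup>2)"
proof -
  let ?t = "\<lambda>i. row_prod i x"
  have "(\<Sum>i<n. \<Sum>l<m. P l * (sgd_step h (\<lambda>_. 0) i x l)\<^sup>2)
      = (\<Sum>i<n. (\<Sum>l<m. P l * (x l)\<^sup>2) - (\<Sum>l<m. 2 * h * P l * x l * (?t i * b i l))
          + h\<^sup>2 * (?t i)\<^sup>2 * (\<Sum>l<m. P l * (b i l)\<^sup>2))"
    unfolding sum_distrib_left sum_subtractf[symmetric] sum.distrib[symmetric]
    by (intro sum.cong refl) (simp add: sgd_step_def power2_eq_square algebra_simps)
  also have "\<dots> \<le> (\<Sum>i<n. (\<Sum>l<m. P l * (x l)\<^sup>2) - (\<Sum>l<m. 2 * h * P l * x l * (?t i * b i l))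
          + h\<^sup>2 * (?t i)\<^sup>2 * (real n * \<phi>))"
    by (intro sum_mono add_left_mono mult_left_mono weighted_row_le P) auto
  also have "\<dots> = real n * (\<Sum>l<m. P l * (x l)\<^sup>2)
      - (\<Sum>l<m. 2 * h * P l * x l * (\<Sum>i<n. ?t i * b i l))
      + h\<^sup>2 * (real n * \<phi>) * (\<Sum>i<n. (?t i)\<^sup>2)"
  proof -
    have "(\<Sum>i<n. \<Sum>l<m. 2 * h * P l * x l * (?t i * b i l))
        = (\<Sum>l<m. 2 * h * P l * x l * (\<Sum>i<n. ?t i * b i l))"
      by (subst sum.swap) (simp add: sum_distrib_left)
    then show ?thesis
      by (simp add: sum.distrib sum_subtractf sum_distrib_left mult_ac)
  qed
  also have "\<dots> = real n * ((\<Sum>l<m. P l * (x l)\<^sup>2) - (\<Sum>l<m. 2 * h * P l * lam l * (x l)\<^sup>2)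
      + h\<^sup>2 * (real n * \<phi>) * (\<Sum>l<m. lam l * (x l)\<^sup>2))"
  proof -
    have "(\<Sum>l<m. 2 * h * P l * x l * (\<Sum>i<n. ?t i * b i l))
        = real n * (\<Sum>l<m. 2 * h * P l * lam l * (x l)\<^sup>2)"
      unfolding sum_distrib_left[of "real n"]
      by (intro sum.cong refl) (subst sum_row_prod_coord, auto simp: power2_eq_square)
    then show ?thesis
      unfolding sum_row_prod_sq by (simp add: algebra_simps)
  qed
  also have "\<dots> \<le> real n * ((\<Sum>l<m. P l * (1 - h * lam l)\<^sup>2 * (x l)\<^sup>2)
      + h\<^sup>2 * (real n * \<phi>) * (\<Sum>l<m. lam l * (x l)\<^sup>2))"
  proof (intro mult_left_mono add_right_mono)
    \<comment> \<open>Adding the nonnegative term P (h lam x)^2 completes the contraction factor (1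
      - h lam)^2.\<close>
    have "P l * (x l)\<^sup>2 - 2 * h * P l * lam l * (x l)\<^sup>2 \<le> P l * (1 - h * lam l)\<^sup>2 * (x l)\<^sup>2"
      if "l < m" for l
    proof -
      have "P l * (1 - h * lam l)\<^sup>2 * (x l)\<^sup>2
          = P l * (x l)\<^sup>2 - 2 * h * P l * lam l * (x l)\<^sup>2 + P l * (h * lam l * x l)\<^sup>2"
        by (simp add: power2_eq_square algebra_simps)
      then show ?thesis
        using P(2)[OF that] by simp
    qed
    then show "(\<Sum>l<m. P l * (x l)\<^sup>2) - (\<Sum>l<m. 2 * h * P l * lam l * (x l)\<^sup>2)
        \<le> (\<Sum>l<m. P l * (1 - h * lam l)\<^sup>2 * (x l)\<^sup>2)"
      unfolding sum_subtractf[symmetric] by (intro sum_mono) auto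
  qed simp
  finally show ?thesis
    using n_pos by (simp add: field_simps)
qed


section \<open>Mean energies of the noise-free iteration\<close>

definition weighted_energy ::
    "(nat \<Rightarrow> real) \<Rightarrow> (nat \<Rightarrow> real) \<Rightarrow> nat \<Rightarrow> (nat \<Rightarrow> real) \<Rightarrow> real" where
  "weighted_energy \<eta> z k P = path_mean n k (\<lambda>f. \<Sum>l<m. P l * (iter \<eta> (\<lambda>_. 0) z f k l)\<^sup>2)"

text \<open>This is E_k of the overview, and the weight \<open>lam\<close> gives F_k. Products of
  contraction factors appear as weights when the iteration is unrolled.\<close>

abbreviation energy :: "(nat \<Rightarrow> real) \<Rightarrow> (nat \<Rightarrow> real) \<Rightarrow> nat \<Rightarrow> real" where
  "energy \<eta> z k \<equiv> weighted_energy \<eta> z k (\<lambda>_. 1)"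

lemma weighted_energy_nonneg:
  "(\<And>l. l < m \<Longrightarrow> 0 \<le> P l) \<Longrightarrow> 0 \<le> weighted_energy \<eta> z k P"
  unfolding weighted_energy_def by (intro path_mean_nonneg sum_nonneg) auto

lemma weighted_energy_mono:
  assumes "\<And>l. l < m \<Longrightarrow> P l \<le> Q l"
  shows "weighted_energy \<eta> z k P \<le> weighted_energy \<eta> z k Q"
  unfolding weighted_energy_def
  by (intro path_mean_mono sum_mono mult_right_mono) (use assms in auto)

lemma weighted_energy_cmult:
  "weighted_energy \<eta> z k (\<lambda>l. c * P l) = c * weighted_energy \<eta> z k P"
  unfolding weighted_energy_def path_mean_cmult[symmetric] by (simp add: sum_distrib_left mult_ac)

lemma energy_Suc_le:
  assumes h: "0 \<le> \<eta> (Suc k)" "\<eta> (Suc k) \<le> c0"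
  shows "energy \<eta> z (Suc k) \<le> energy \<eta> z k - \<eta> (Suc k) * weighted_energy \<eta> z k lam"
proof -
  have "energy \<eta> z (Suc k) \<le> path_mean n k (\<lambda>f. (\<Sum>l<m. (iter \<eta> (\<lambda>_. 0) z f k l)\<^sup>2)
      + (- \<eta> (Suc k)) * (\<Sum>l<m. lam l * (iter \<eta> (\<lambda>_. 0) z f k l)\<^sup>2))"
    unfolding weighted_energy_def path_mean_iter_Suc[of k "\<lambda>x. \<Sum>l<m. 1 * (x l)\<^sup>2"]
    by (intro path_mean_mono) (use mean_step_norm_le[OF h] in simp)
  then show ?thesis
    unfolding path_mean_add path_mean_cmult by (simp add: weighted_energy_def)
qed

lemma weighted_energy_Suc_le:
  assumes P: "0 \<le> \<phi>" "\<And>l. l < m \<Longrightarrow> 0 \<le> P l" "\<And>l. l < m \<Longrightarrow> lam l * P l \<le> \<phi>"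
  shows "weighted_energy \<eta> z (Suc k) P
    \<le> weighted_energy \<eta> z k (\<lambda>l. P l * (1 - \<eta> (Suc k) * lam l)\<^sup>2)
      + (\<eta> (Suc k))\<^sup>2 * (real n * \<phi>) * weighted_energy \<eta> z k lam"
proof -
  let ?x = "\<lambda>f. iter \<eta> (\<lambda>_. 0) z f k"
  have "weighted_energy \<eta> z (Suc k) P
    \<le> path_mean n k (\<lambda>f. (\<Sum>l<m. P l * (1 - \<eta> (Suc k) * lam l)\<^sup>2 * (?x f l)\<^sup>2)
      + (\<eta> (Suc k))\<^sup>2 * (real n * \<phi>) * (\<Sum>l<m. lam l * (?x f l)\<^sup>2))"
    unfolding weighted_energy_def path_mean_iter_Suc[of k "\<lambda>x. \<Sum>l<m. P l * (x l)\<^sup>2"]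
    by (intro path_mean_mono mean_step_weighted_le P)
  then show ?thesis
    unfolding path_mean_add path_mean_cmult by (simp add: weighted_energy_def)
qed

text \<open>Steps are undone backwards from \<open>K\<close>: the contraction factor of a step moves
  into the weight, and its random part leaves one summand. \<open>\<phi> j\<close> bounds
  \<open>lam\<close> times the weight collected from the steps after \<open>j\<close>.\<close>

lemma energy_unroll:
  assumes \<phi>: "\<And>j l. j \<in> {1..K} \<Longrightarrow> l < m \<Longrightarrow>
      lam l * (\<Prod>i\<in>{j<..K}. (1 - \<eta> i * lam l)\<^sup>2) \<le> \<phi> j"
    and \<phi>0: "\<And>j. 0 \<le> \<phi> j"
    and j: "j \<le> K"
  shows "energy \<eta> z K \<le> weighted_energy \<eta> z j (\<lambda>l. \<Prod>i\<in>{j<..K}. (1 - \<eta> i * lam l)\<^sup>2)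
    + (\<Sum>i\<in>{j<..K}. (\<eta> i)\<^sup>2 * (real n * \<phi> i) * weighted_energy \<eta> z (i - 1) lam)"
  using j
proof (induction j rule: inc_induct)
  case base
  then show ?case by simp
next
  case (step j)
  let ?P = "\<lambda>j l. \<Prod>i\<in>{j<..K}. (1 - \<eta> i * lam l)\<^sup>2"
  have split: "{j<..K} = insert (Suc j) {Suc j<..K}"
    using step.hyps by auto
  have "weighted_energy \<eta> z (Suc j) (?P (Suc j))
      \<le> weighted_energy \<eta> z j (\<lambda>l. ?P (Suc j) l * (1 - \<eta> (Suc j) * lam l)\<^sup>2)
      + (\<eta> (Suc j))\<^sup>2 * (real n * \<phi> (Suc j)) * weighted_energy \<eta> z j lam"
    by (rule weighted_energy_Suc_le) (use \<phi> \<phi>0 step.hyps in \<open>auto intro: prod_nonneg\<close>)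
  also have "(\<lambda>l. ?P (Suc j) l * (1 - \<eta> (Suc j) * lam l)\<^sup>2) = ?P j"
    by (simp add: split mult.commute)
  finally show ?case
    using step.IH by (simp add: split)
qed

lemma energy_antimono:
  assumes "\<And>j. 1 \<le> j \<Longrightarrow> 0 \<le> \<eta> j \<and> \<eta> j \<le> c0" and "j \<le> k"
  shows "energy \<eta> z k \<le> energy \<eta> z j"
  using assms(2)
proof (induction k rule: dec_induct)
  case (step k)
  have "0 \<le> \<eta> (Suc k) * weighted_energy \<eta> z k lam"
    using assms(1)[of "Suc k"] lam_nonneg by (intro mult_nonneg_nonneg weighted_energy_nonneg) auto
  then show ?case
    using energy_Suc_le[of \<eta> k z] assms(1)[of "Suc k"] step.IH by simp
qed simp

text \<open>Telescoping \<open>energy_Suc_le\<close>: the energy at the end is nonnegative.\<close>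

lemma sum_dissipation_le:
  assumes "\<And>j. 1 \<le> j \<Longrightarrow> 0 \<le> \<eta> j \<and> \<eta> j \<le> c0"
  shows "(\<Sum>i\<in>{1..k}. \<eta> i * weighted_energy \<eta> z (i - 1) lam) \<le> energy \<eta> z 0"
proof -
  have "(\<Sum>i\<in>{1..k}. \<eta> i * weighted_energy \<eta> z (i - 1) lam) \<le> energy \<eta> z 0 - energy \<eta> z k"
  proof (induction k)
    case (Suc k)
    then show ?case
      using energy_Suc_le[of \<eta> k z] assms[of "Suc k"] by simp
  qed simp
  then show ?thesis
    using weighted_energy_nonneg[of "\<lambda>_. 1" \<eta> z k] by simp
qed

text \<open>Started at zero, the mean energy grows in each step by at most the step size times the
  mean squared noise.\<close>

lemma noise_energy_le:
  assumes \<eta>: "\<And>j. 1 \<le> j \<Longrightarrow> 0 \<le> \<eta> j \<and> \<eta> j \<le> c0"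
  shows "path_mean n k (\<lambda>f. \<Sum>l<m. (iter \<eta> \<xi> (\<lambda>_. 0) f k l)\<^sup>2)
    \<le> (\<Sum>j\<in>{1..k}. \<eta> j) * ((\<Sum>i<n. (\<xi> i)\<^sup>2) / real n)"
proof (induction k)
  case (Suc k)
  let ?x = "\<lambda>f. iter \<eta> \<xi> (\<lambda>_. 0) f k" and ?h = "\<eta> (Suc k)"
  have "(\<Sum>i<n. \<Sum>l<m. (sgd_step ?h \<xi> i (?x f) l)\<^sup>2) / real n
      \<le> (\<Sum>l<m. (?x f l)\<^sup>2) + ?h * ((\<Sum>i<n. (\<xi> i)\<^sup>2) / real n)" for f
  proof -
    have "(\<Sum>i<n. \<Sum>l<m. (sgd_step ?h \<xi> i (?x f) l)\<^sup>2)
        \<le> (\<Sum>i<n. (\<Sum>l<m. (?x f l)\<^sup>2) + ?h * (\<xi> i)\<^sup>2)"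
      by (intro sum_mono step_norm_noise_le) (use \<eta>[of "Suc k"] in auto)
    also have "\<dots> = real n * (\<Sum>l<m. (?x f l)\<^sup>2) + ?h * (\<Sum>i<n. (\<xi> i)\<^sup>2)"
      by (simp add: sum.distrib sum_distrib_left)
    finally show ?thesis
      using n_pos by (simp add: field_simps)
  qed
  then have "path_mean n (Suc k) (\<lambda>f. \<Sum>l<m. (iter \<eta> \<xi> (\<lambda>_. 0) f (Suc k) l)\<^sup>2)
      \<le> path_mean n k (\<lambda>f. (\<Sum>l<m. (?x f l)\<^sup>2) + ?h * ((\<Sum>i<n. (\<xi> i)\<^sup>2) / real n))"
    unfolding path_mean_iter_Suc[of k "\<lambda>x. \<Sum>l<m. (x l)\<^sup>2"] by (intro path_mean_mono)
  also have "\<dots> = path_mean n k (\<lambda>f. \<Sum>l<m. (?x f l)\<^sup>2) + ?h * ((\<Sum>i<n. (\<xi> i)\<^sup>2) / real n)"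
    by (simp add: path_mean_add path_mean_const n_pos)
  finally show ?case
    using Suc by (simp add: distrib_right add_divide_distrib)
qed simp

lemma iter_energy_le:
  "path_mean n k (\<lambda>f. \<Sum>l<m. (iter \<eta> \<xi> z f k l)\<^sup>2)
    \<le> 2 * energy \<eta> z k + 2 * path_mean n k (\<lambda>f. \<Sum>l<m. (iter \<eta> \<xi> (\<lambda>_. 0) f k l)\<^sup>2)"
proof -
  have sq: "(u + v)\<^sup>2 \<le> 2 * u\<^sup>2 + 2 * v\<^sup>2" for u v :: real
    using zero_le_power2[of "u - v"] by (simp add: power2_eq_square algebra_simps)
  have "path_mean n k (\<lambda>f. \<Sum>l<m. (iter \<eta> \<xi> z f k l)\<^sup>2)
      \<le> path_mean n k (\<lambda>f. 2 * (\<Sum>l<m. (iter \<eta> (\<lambda>_. 0) z f k l)\<^sup>2)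
        + 2 * (\<Sum>l<m. (iter \<eta> \<xi> (\<lambda>_. 0) f k l)\<^sup>2))"
    unfolding sum_distrib_left sum.distrib[symmetric]
    by (intro path_mean_mono sum_mono) (subst iter_decompose, rule sq)
  then show ?thesis
    by (simp add: path_mean_add path_mean_cmult weighted_energy_def)
qed

end

section \<open>Convergence rate of the noise-free iteration\<close>

lemma mult_exp_le:
  fixes s T :: real
  assumes "0 \<le> s" "0 < T"
  shows "s * exp (- (2 * s * T)) \<le> 1 / T"
proof -
  have "s * T \<le> exp (2 * s * T)"
    using exp_ge_add_one_self[of "2 * s * T"] mult_nonneg_nonneg[of s T] assms by linarith
  then show ?thesis
    using assms by (simp add: exp_minus field_simps)
qed

lemma prod_one_minus_sq_le_exp:
  fixes \<eta> :: "nat \<Rightarrow> real"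
  assumes "\<And>i. i \<in> S \<Longrightarrow> 0 \<le> \<eta> i * x \<and> \<eta> i * x \<le> 1"
  shows "(\<Prod>i\<in>S. (1 - \<eta> i * x)\<^sup>2) \<le> exp (- (2 * x * (\<Sum>i\<in>S. \<eta> i)))"
\<comment> \<open>For infinite \<open>S\<close> the product is 1 and the sum is 0 by convention, so
  both sides equal 1.\<close>
proof (cases "finite S")
  case True
  have "(\<Prod>i\<in>S. (1 - \<eta> i * x)\<^sup>2) \<le> (\<Prod>i\<in>S. exp (- (2 * x * \<eta> i)))"
  proof (rule prod_mono)
    fix i assume i: "i \<in> S"
    have "(1 - \<eta> i * x)\<^sup>2 \<le> (exp (- (\<eta> i * x)))\<^sup>2"
      using assms[OF i] exp_ge_add_one_self[of "- (\<eta> i * x)"] by (intro power_mono) auto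
    then show "0 \<le> (1 - \<eta> i * x)\<^sup>2 \<and> (1 - \<eta> i * x)\<^sup>2 \<le> exp (- (2 * x * \<eta> i))"
      by (simp add: power2_eq_square exp_add[symmetric] mult_ac)
  qed
  then show ?thesis
    using True by (simp add: exp_sum[symmetric] sum_negf sum_distrib_left)
qed simp

lemma sum_inverse_le_ln:
  assumes "1 \<le> k"
  shows "(\<Sum>d\<in>{1..k}. 1 / real d) \<le> 1 + ln (real k)"
  using assms
proof (induction k rule: dec_induct)
  case (step k)
  have "ln (real k / real (Suc k)) \<le> real k / real (Suc k) - 1"
    using step.hyps by (intro ln_le_minus_one) auto
  then have "1 / real (Suc k) \<le> ln (real (Suc k)) - ln (real k)"
    using step.hyps by (simp add: ln_div field_simps)
  then show ?case
    using step.IH by simp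
qed simp

text \<open>By the mean value theorem the right side grows by t^(-\<alpha>) with t < k + 1, hence by
  at least the new summand.\<close>

lemma sum_powr_minus_le:
  assumes \<alpha>: "0 < \<alpha>" "\<alpha> < 1"
  shows "(\<Sum>j\<in>{1..k}. real j powr (- \<alpha>)) \<le> real k powr (1 - \<alpha>) / (1 - \<alpha>)"
proof (induction k)
  case (Suc k)
  have "real (Suc k) powr (- \<alpha>) \<le> (real (Suc k) powr (1 - \<alpha>) - real k powr (1 - \<alpha>)) / (1 - \<alpha>)"
  \<comment> \<open>The power is not differentiable at 0, so the first step is checked
    directly.\<close>
  proof (cases "k = 0")
    case True
    then show ?thesis
      using \<alpha> by simp
  next
    case False
    have "\<exists>t>real k. t < real (Suc k) \<and> real (Suc k) powr (1 - \<alpha>) - real k powr (1 - \<alpha>)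
        = (real (Suc k) - real k) * ((1 - \<alpha>) * t powr (- \<alpha>))"
      using False by (intro MVT2) (auto intro!: derivative_eq_intros)
    then obtain t where t: "real k < t" "t < real (Suc k)"
        "real (Suc k) powr (1 - \<alpha>) - real k powr (1 - \<alpha>) = (1 - \<alpha>) * t powr (- \<alpha>)"
      by auto
    have "real (Suc k) powr (- \<alpha>) \<le> t powr (- \<alpha>)"
      using t \<alpha> False by (intro powr_mono2') auto
    then show ?thesis
      using t \<alpha> by (simp del: of_nat_Suc)
  qed
  then show ?case
    using Suc by (simp add: diff_divide_distrib)
qed simp

lemma rpow_nonneg: "0 \<le> rpow t p"
  by (simp add: rpow_def)

lemma rpow_mult: "0 \<le> s \<Longrightarrow> 0 \<le> t \<Longrightarrow> rpow (s * t) p = rpow s p * rpow t p"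
  by (simp add: rpow_def powr_mult)

lemma rpow_mono: "0 \<le> s \<Longrightarrow> s \<le> t \<Longrightarrow> 0 \<le> p \<Longrightarrow> rpow s p \<le> rpow t p"
  by (simp add: rpow_def powr_mono2)

lemma rpow_pos_eq_powr: "0 < t \<Longrightarrow> rpow t p = t powr p"
  by (simp add: rpow_def)

text \<open>On [0, 1] lowering the exponent increases the power. Capping \<open>2 * p\<close> at 1
  is where the rate saturates.\<close>

lemma rpow_sq_le:
  assumes s: "0 \<le> s" "s \<le> 1" and p: "0 \<le> p"
  shows "(rpow s p)\<^sup>2 \<le> rpow s (min 1 (2 * p))"
proof (cases "p = 0 \<or> s = 0")
  case True
  then show ?thesis
    using p by (auto simp: rpow_def)
next
  case False
  then have "(rpow s p)\<^sup>2 = s powr (2 * p)"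
    using s by (simp add: rpow_def power2_eq_square powr_add[symmetric])
  also have "\<dots> \<le> s powr (min 1 (2 * p))"
    using False s by (intro powr_mono') auto
  also have "\<dots> = rpow s (min 1 (2 * p))"
    using False s by (simp add: rpow_pos_eq_powr)
  finally show ?thesis .
qed

text \<open>Because \<open>q \<le> 1\<close>, the exponential is at most its own \<open>q\<close>-th
  power, which leads to the \<open>q\<close>-th power of the quantity in
  \<open>mult_exp_le\<close>.\<close>

lemma rpow_mult_exp_le:
  assumes s: "0 \<le> s" and T: "0 < T" and q: "0 \<le> q" "q \<le> 1"
  shows "rpow s q * exp (- (2 * s * T)) \<le> T powr (- q)"
proof (cases "q = 0")
  case True
  then show ?thesis
    using s T by (simp add: rpow_def)
next
  case False
  have "exp (- (2 * s * T)) \<le> exp (- (2 * s * T) * q)"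
    using s T q by (simp add: mult_left_le)
  then have "rpow s q * exp (- (2 * s * T)) \<le> s powr q * exp (- (2 * s * T)) powr q"
    using False by (auto simp: rpow_def exp_powr_real intro!: mult_left_mono)
  also have "\<dots> = (s * exp (- (2 * s * T))) powr q"
    using s by (simp add: powr_mult)
  also have "\<dots> \<le> (1 / T) powr q"
    using mult_exp_le[OF s T] s q by (intro powr_mono2) auto
  also have "\<dots> = T powr (- q)"
    using T by (simp add: powr_divide powr_minus_divide)
  finally show ?thesis .
qed

text \<open>\<open>a\<close> stands for |A|^2 and \<open>\<omega>\<close> for |w|^2. The power of
  \<open>c0\<close> comes from rescaling the spectrum of B into [0, 1]. The summand 1 serves
  \<open>bias_le\<close>, the other one \<open>initial_energy_le\<close>.\<close>

definition source_const :: "real \<Rightarrow> real \<Rightarrow> real \<Rightarrow> real \<Rightarrow> real" where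
  "source_const p \<omega> a c0 = c0 powr (- 2 * p) * \<omega> * (1 + rpow (c0 * a) (min 1 (2 * p)))"

text \<open>\<open>H\<close> is the factor in \<open>energy_recursion\<close>. Using that recursion
  twice gives the sum in parentheses, where 15 = 5 * 3 and each 3 comes from replacing k/2 by k; the
  9 comes from (1 + ln k)^2 <= 9 (ln k)^2.\<close>

definition rate_const :: "real \<Rightarrow> real \<Rightarrow> real \<Rightarrow> real \<Rightarrow> real" where
  "rate_const p \<omega> a c0 = (let D = source_const p \<omega> a c0; H = 8 * c0 * a in
     9 * (5 * D + 15 * H * D + 3 * H\<^sup>2 * D))"

section \<open>The rate under the source condition\<close>

context gram_system
begin

text \<open>The source equation for \<open>z\<close> is squared because the initial error is x_1 -
  xdag, whereas the source condition concerns xdag - x_1.\<close>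

context
  fixes \<alpha> p a \<omega> :: real and \<eta> z w :: "nat \<Rightarrow> real"
  assumes \<alpha>: "0 < \<alpha>" "\<alpha> < 1" and p: "0 \<le> p" and a0: "0 \<le> a"
    and \<eta>: "\<And>j. 1 \<le> j \<Longrightarrow> \<eta> j = c0 * real j powr (- \<alpha>)"
    and lam_le: "\<And>l. l < m \<Longrightarrow> real n * lam l \<le> a"
    and z: "\<And>l. l < m \<Longrightarrow> (z l)\<^sup>2 = (rpow (lam l) p * w l)\<^sup>2"
    and \<omega>: "(\<Sum>l<m. (w l)\<^sup>2) = \<omega>"
begin

abbreviation (input) "q \<equiv> min 1 (2 * p)"

abbreviation (input) "D \<equiv> source_const p \<omega> a c0"

lemma \<omega>_nonneg: "0 \<le> \<omega>"
  unfolding \<omega>[symmetric] by (intro sum_nonneg) auto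

lemma q_bounds: "0 \<le> q" "q \<le> 1"
  using p by auto

lemma source_const_nonneg: "0 \<le> D"
  unfolding source_const_def using \<omega>_nonneg rpow_nonneg[of "c0 * a" q] by auto

lemma \<eta>_bounds: "1 \<le> j \<Longrightarrow> 0 \<le> \<eta> j \<and> \<eta> j \<le> c0"
  using \<eta>[of j] c0_pos \<alpha> powr_mono[of "- \<alpha>" 0 "real j"] by (auto simp: mult_left_le)

lemma \<eta>_lam_bounds: "1 \<le> j \<Longrightarrow> l < m \<Longrightarrow> 0 \<le> \<eta> j * lam l \<and> \<eta> j * lam l \<le> 1"
  using \<eta>_bounds[of j] c0_lam_le[of l] lam_nonneg[of l]
  by (meson mult_nonneg_nonneg mult_right_mono order_trans)

lemma z_sq_le:
  assumes l: "l < m"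
  shows "(z l)\<^sup>2 \<le> c0 powr (- 2 * p) * rpow (c0 * lam l) q * (w l)\<^sup>2"
proof -
  have "rpow (lam l) p = rpow (1 / c0 * (c0 * lam l)) p"
    using c0_pos by simp
  also have "\<dots> = c0 powr (- p) * rpow (c0 * lam l) p"
    using c0_pos lam_nonneg[OF l]
    by (subst rpow_mult) (simp_all add: rpow_pos_eq_powr powr_divide powr_minus_divide)
  finally have "(z l)\<^sup>2 = c0 powr (- 2 * p) * (rpow (c0 * lam l) p)\<^sup>2 * (w l)\<^sup>2"
    using z[OF l] by (simp add: power_mult_distrib power2_eq_square powr_add[symmetric])
  also have "\<dots> \<le> c0 powr (- 2 * p) * rpow (c0 * lam l) q * (w l)\<^sup>2"
    using c0_lam_le[OF l] lam_nonneg[OF l] c0_pos p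
    by (intro mult_right_mono mult_left_mono rpow_sq_le) auto
  finally show ?thesis .
qed

lemma weighted_energy_0: "weighted_energy \<eta> z 0 P = (\<Sum>l<m. P l * (z l)\<^sup>2)"
  by (simp add: weighted_energy_def)

lemma initial_weighted_energy_le:
  assumes P: "\<And>l. l < m \<Longrightarrow> 0 \<le> P l" "\<And>l. l < m \<Longrightarrow> rpow (c0 * lam l) q * P l \<le> t"
  shows "weighted_energy \<eta> z 0 P \<le> c0 powr (- 2 * p) * \<omega> * t"
proof -
  have "weighted_energy \<eta> z 0 P
      \<le> (\<Sum>l<m. P l * (c0 powr (- 2 * p) * rpow (c0 * lam l) q * (w l)\<^sup>2))"
    unfolding weighted_energy_0 by (intro sum_mono mult_left_mono z_sq_le) (use P in auto)
  also have "\<dots> = (\<Sum>l<m. c0 powr (- 2 * p) * (w l)\<^sup>2 * (rpow (c0 * lam l) q * P l))"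
    by (simp add: mult_ac)
  also have "\<dots> \<le> (\<Sum>l<m. c0 powr (- 2 * p) * (w l)\<^sup>2 * t)"
    by (intro sum_mono mult_left_mono) (use P in auto)
  also have "\<dots> = c0 powr (- 2 * p) * \<omega> * t"
    by (simp add: \<omega>[symmetric] sum_distrib_left sum_distrib_right)
  finally show ?thesis .
qed

text \<open>All eigenvalues are at most \<open>a / n\<close>, so the source condition makes the
  initial error small for large \<open>n\<close>. This gain keeps the final constants independent of
  \<open>n\<close>.\<close>

lemma initial_energy_le: "energy \<eta> z 0 \<le> D * real n powr (- q)"
proof -
  have "energy \<eta> z 0 \<le> c0 powr (- 2 * p) * \<omega> * (rpow (c0 * a) q * real n powr (- q))"
  proof (rule initial_weighted_energy_le)
    fix l assume l: "l < m"
    have "rpow (c0 * lam l) q \<le> rpow (c0 * a * (1 / real n)) q"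
      using lam_le[OF l] lam_nonneg[OF l] c0_pos n_pos q_bounds
      by (intro rpow_mono) (auto simp: field_simps)
    also have "\<dots> = rpow (c0 * a) q * real n powr (- q)"
      using a0 c0_pos n_pos
      by (subst rpow_mult) (auto simp: rpow_pos_eq_powr powr_divide powr_minus_divide)
    finally show "rpow (c0 * lam l) q * 1 \<le> rpow (c0 * a) q * real n powr (- q)"
      by simp
  qed simp
  also have "\<dots> \<le> c0 powr (- 2 * p) * \<omega> * ((1 + rpow (c0 * a) q) * real n powr (- q))"
    using \<omega>_nonneg by (intro mult_left_mono mult_right_mono) auto
  finally show ?thesis
    by (simp add: source_const_def mult_ac)
qed

lemma initial_energy_le_const: "energy \<eta> z 0 \<le> D"
proof -
  have "real n powr (- q) \<le> 1"
    using n_pos q_bounds powr_mono[of "- q" 0 "real n"] by auto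
  then have "D * real n powr (- q) \<le> D * 1"
    using source_const_nonneg by (intro mult_left_mono)
  then show ?thesis
    using initial_energy_le by simp
qed

lemma sum_steps_ge:
  "c0 * real (k - j) * real k powr (- \<alpha>) \<le> (\<Sum>i\<in>{j<..k}. \<eta> i)"
proof -
  have "(\<Sum>i\<in>{j<..k}. c0 * real k powr (- \<alpha>)) \<le> (\<Sum>i\<in>{j<..k}. \<eta> i)"
    using \<alpha> c0_pos by (intro sum_mono) (auto simp: \<eta> intro!: powr_mono2')
  then show ?thesis
    by (simp add: mult_ac)
qed

lemma bias_le:
  assumes k: "1 \<le> k"
  shows "weighted_energy \<eta> z 0 (\<lambda>l. \<Prod>i\<in>{0<..k}. (1 - \<eta> i * lam l)\<^sup>2)
    \<le> D * real k powr (- (q * (1 - \<alpha>)))"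
proof -
  \<comment> \<open>Up to the factor \<open>c0\<close>, the first \<open>k\<close> step sizes sum to
    at least \<open>T\<close>, which acts as the time in \<open>rpow_mult_exp_le\<close>.\<close>
  define T where "T = real k powr (1 - \<alpha>)"
  have T: "0 < T"
    using k by (simp add: T_def)
  have "real k * real k powr (- \<alpha>) = T"
    using k unfolding T_def by (subst powr_mult_base) auto
  then have S: "c0 * T \<le> (\<Sum>i\<in>{0<..k}. \<eta> i)"
    using sum_steps_ge[of k 0] by (simp add: mult_ac)
  have "weighted_energy \<eta> z 0 (\<lambda>l. \<Prod>i\<in>{0<..k}. (1 - \<eta> i * lam l)\<^sup>2)
      \<le> c0 powr (- 2 * p) * \<omega> * T powr (- q)"
  proof (rule initial_weighted_energy_le)
    fix l assume l: "l < m"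
    have "(\<Prod>i\<in>{0<..k}. (1 - \<eta> i * lam l)\<^sup>2) \<le> exp (- (2 * lam l * (\<Sum>i\<in>{0<..k}. \<eta> i)))"
      by (intro prod_one_minus_sq_le_exp \<eta>_lam_bounds l) auto
    also have "\<dots> \<le> exp (- (2 * (c0 * lam l) * T))"
      using mult_left_mono[OF S lam_nonneg[OF l]] by (simp add: mult_ac)
    finally have "rpow (c0 * lam l) q * (\<Prod>i\<in>{0<..k}. (1 - \<eta> i * lam l)\<^sup>2)
        \<le> rpow (c0 * lam l) q * exp (- (2 * (c0 * lam l) * T))"
      by (intro mult_left_mono rpow_nonneg)
    also have "\<dots> \<le> T powr (- q)"
      using T q_bounds c0_pos lam_nonneg[OF l] by (intro rpow_mult_exp_le) auto
    finally show "rpow (c0 * lam l) q * (\<Prod>i\<in>{0<..k}. (1 - \<eta> i * lam l)\<^sup>2) \<le> T powr (- q)" .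
  qed (auto intro: prod_nonneg)
  also have "\<dots> \<le> D * T powr (- q)"
  proof -
    have "c0 powr (- 2 * p) * \<omega> * 1 \<le> D"
      unfolding source_const_def using \<omega>_nonneg rpow_nonneg[of "c0 * a" q] by (intro mult_left_mono) auto
    then show ?thesis
      by (intro mult_right_mono) auto
  qed
  also have "T powr (- q) = real k powr (- (q * (1 - \<alpha>)))"
    by (simp only: T_def powr_powr) (simp add: algebra_simps)
  finally show ?thesis .
qed

text \<open>The shift by 1 keeps the bound finite at \<open>j = k\<close>, where the product of
  contraction factors is empty. The factor 2 pays for it, as k - j + 1 <= 2 (k - j) for j <
  k.\<close>

definition "filter_bound k j = 2 * real k powr \<alpha> / (c0 * real (k - j + 1))"

lemma filter_bound:
  assumes j: "j \<in> {1..k}" and l: "l < m"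
  shows "lam l * (\<Prod>i\<in>{j<..k}. (1 - \<eta> i * lam l)\<^sup>2) \<le> filter_bound k j"
proof (cases "j = k")
  case True
  have "1 \<le> real k powr \<alpha>"
    using j \<alpha> by (intro ge_one_powr_ge_zero) auto
  then have "c0 * lam l \<le> 2 * real k powr \<alpha>"
    using c0_lam_le[OF l] by simp
  then show ?thesis
    using True c0_pos by (simp add: filter_bound_def field_simps)
next
  case False
  define S where "S = (\<Sum>i\<in>{j<..k}. \<eta> i)"
  have kj: "0 < real (k - j)" "real (k - j + 1) \<le> 2 * real (k - j)"
    using False j by auto
  have S: "c0 * real (k - j) * real k powr (- \<alpha>) \<le> S"
    unfolding S_def by (rule sum_steps_ge)
  have pos: "0 < c0 * real (k - j) * real k powr (- \<alpha>)"
    using kj c0_pos j by auto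
  have "lam l * (\<Prod>i\<in>{j<..k}. (1 - \<eta> i * lam l)\<^sup>2) \<le> lam l * exp (- (2 * lam l * S))"
    unfolding S_def using lam_nonneg[OF l]
    by (intro mult_left_mono prod_one_minus_sq_le_exp \<eta>_lam_bounds l) (use j in auto)
  also have "\<dots> \<le> 1 / S"
    using lam_nonneg[OF l] less_le_trans[OF pos S] by (intro mult_exp_le)
  also have "\<dots> \<le> 1 / (c0 * real (k - j) * real k powr (- \<alpha>))"
    by (rule divide_left_mono[OF S _ mult_pos_pos[OF less_le_trans[OF pos S] pos]]) simp
  also have "\<dots> = 2 * real k powr \<alpha> / (c0 * (2 * real (k - j)))"
    using c0_pos by (simp add: powr_minus field_simps)
  also have "\<dots> \<le> filter_bound k j"
    unfolding filter_bound_def using c0_pos kj by (intro divide_left_mono mult_left_mono) auto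
  finally show ?thesis .
qed

lemma filter_bound_nonneg: "0 \<le> filter_bound k j"
  using c0_pos by (simp add: filter_bound_def)

lemma dissipation_nonneg: "0 \<le> weighted_energy \<eta> z k lam"
  by (intro weighted_energy_nonneg lam_nonneg)

lemma n_dissipation_le: "real n * weighted_energy \<eta> z k lam \<le> a * energy \<eta> z k"
  unfolding weighted_energy_cmult[symmetric]
  by (intro weighted_energy_mono) (use lam_le in simp)

text \<open>For these \<open>j\<close> the filter bound is at most 4 / (c0 T). One factor
  \<open>\<eta> j\<close> is bounded by \<open>c0\<close>, the other enters the dissipation sum,
  which is at most E_0. This leaves n^(1-q) / T, and the assumption on \<open>n\<close> bounds it by
  T^(-q).\<close>

lemma early_le:
  assumes k: "1 \<le> k" and n: "real n \<le> real k powr (1 - \<alpha>)"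
  shows "(\<Sum>j\<in>{1..k div 2}. (\<eta> j)\<^sup>2 * (real n * filter_bound k j) * weighted_energy \<eta> z (j - 1) lam)
    \<le> 4 * D * real k powr (- (q * (1 - \<alpha>)))"
proof -
  define T where "T = real k powr (1 - \<alpha>)"
  have T: "0 < T"
    using k by (simp add: T_def)
  let ?F = "\<lambda>j. weighted_energy \<eta> z (j - 1) lam"
  have "(\<eta> j)\<^sup>2 * (real n * filter_bound k j) * ?F j \<le> 4 * real n / T * (\<eta> j * ?F j)"
    if j: "j \<in> {1..k div 2}" for j
  proof -
    have kj: "real k / 2 \<le> real (k - j + 1)"
      using j by auto
    have "filter_bound k j \<le> 2 * real k powr \<alpha> / (c0 * (real k / 2))"
      unfolding filter_bound_def using c0_pos kj k by (intro divide_left_mono mult_left_mono) auto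
    also have "\<dots> = 4 / (c0 * T)"
      using k by (simp add: T_def powr_diff)
    finally have \<phi>: "c0 * filter_bound k j \<le> 4 / T"
      using mult_left_mono[of "filter_bound k j" "4 / (c0 * T)" c0] c0_pos by simp
    have "\<eta> j * filter_bound k j \<le> c0 * filter_bound k j"
      using \<eta>_bounds[of j] j filter_bound_nonneg by (intro mult_right_mono) auto
    then have "\<eta> j * filter_bound k j \<le> 4 / T"
      using \<phi> by simp
    then have "(\<eta> j * filter_bound k j) * (real n * (\<eta> j * ?F j)) \<le> 4 / T * (real n * (\<eta> j * ?F j))"
      using \<eta>_bounds[of j] j dissipation_nonneg by (intro mult_right_mono) auto
    then show ?thesis
      by (simp add: power2_eq_square mult_ac)
  qed
  then have "(\<Sum>j\<in>{1..k div 2}. (\<eta> j)\<^sup>2 * (real n * filter_bound k j) * ?F j)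
      \<le> (\<Sum>j\<in>{1..k div 2}. 4 * real n / T * (\<eta> j * ?F j))"
    by (rule sum_mono)
  also have "\<dots> = 4 * real n / T * (\<Sum>j\<in>{1..k div 2}. \<eta> j * ?F j)"
    by (simp add: sum_distrib_left)
  also have "\<dots> \<le> 4 * real n / T * (D * real n powr (- q))"
    using sum_dissipation_le[of \<eta> z "k div 2", OF \<eta>_bounds] initial_energy_le T
    by (intro mult_left_mono) auto
  also have "\<dots> = 4 * D * (real n powr (1 - q)) / T"
    using n_pos by (simp add: powr_diff powr_minus field_simps)
  also have "\<dots> \<le> 4 * D * (T powr (1 - q)) / T"
    using n q_bounds source_const_nonneg T
    by (intro divide_right_mono mult_left_mono powr_mono2) (auto simp: T_def)
  also have "\<dots> = 4 * D * T powr (- q)"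
    using T by (simp add: powr_diff powr_minus field_simps)
  also have "T powr (- q) = real k powr (- (q * (1 - \<alpha>)))"
    by (simp only: T_def powr_powr) (simp add: algebra_simps)
  finally show ?thesis .
qed

text \<open>After k/2 the step sizes are at most 2 c0 k^(-\<alpha>) and the energies at most
  E_{k/2}. The filter bounds form a harmonic sum, the source of the logarithm.\<close>

lemma late_le:
  assumes k: "1 \<le> k"
  shows "(\<Sum>j\<in>{k div 2<..k}. (\<eta> j)\<^sup>2 * (real n * filter_bound k j) * weighted_energy \<eta> z (j - 1) lam)
    \<le> 8 * c0 * a * real k powr (- \<alpha>) * (1 + ln (real k)) * energy \<eta> z (k div 2)"
proof -
  let ?F = "\<lambda>j. weighted_energy \<eta> z (j - 1) lam" and ?E = "energy \<eta> z (k div 2)"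
  have E0: "0 \<le> ?E"
    by (intro weighted_energy_nonneg) simp
  have "(\<eta> j)\<^sup>2 * (real n * filter_bound k j) * ?F j
      \<le> 8 * c0 * a * real k powr (- \<alpha>) * ?E * (1 / real (k - j + 1))"
    if j: "j \<in> {k div 2<..k}" for j
  proof -
    have "real k / 2 \<le> real j"
      using j by auto
    then have "real j powr (- \<alpha>) \<le> (real k * (1 / 2)) powr (- \<alpha>)"
      using k \<alpha> by (intro powr_mono2') auto
    also have "\<dots> = real k powr (- \<alpha>) * 2 powr \<alpha>"
      using k by (subst powr_mult) (auto simp: powr_divide powr_minus_divide)
    also have "\<dots> \<le> real k powr (- \<alpha>) * 2"
      using \<alpha> powr_mono[of \<alpha> 1 2] by (intro mult_left_mono) auto
    finally have "\<eta> j \<le> c0 * (real k powr (- \<alpha>) * 2)"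
      using j c0_pos by (simp add: \<eta>)
    then have "(\<eta> j)\<^sup>2 \<le> (c0 * (real k powr (- \<alpha>) * 2))\<^sup>2"
      using \<eta>_bounds[of j] j by (intro power_mono) auto
    then have 1: "(\<eta> j)\<^sup>2 \<le> 4 * c0\<^sup>2 * (real k powr (- \<alpha>))\<^sup>2"
      by (simp add: power_mult_distrib mult_ac)
    have "real n * ?F j \<le> a * energy \<eta> z (j - 1)"
      by (rule n_dissipation_le)
    \<comment> \<open>\<open>j - 1\<close> is still at least \<open>k div 2\<close>.\<close>
    also have "\<dots> \<le> a * ?E"
      using j a0 by (intro mult_left_mono energy_antimono \<eta>_bounds) auto
    finally have 2: "real n * ?F j \<le> a * ?E" .
    have "(\<eta> j)\<^sup>2 * (real n * filter_bound k j) * ?F j = (\<eta> j)\<^sup>2 * filter_bound k j * (real n * ?F j)"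
      by (simp add: mult_ac)
    also have "\<dots> \<le> (4 * c0\<^sup>2 * (real k powr (- \<alpha>))\<^sup>2) * filter_bound k j * (a * ?E)"
      using 1 2 filter_bound_nonneg dissipation_nonneg by (intro mult_mono[OF mult_right_mono] mult_nonneg_nonneg) auto
    \<comment> \<open>The 8 is 4 from the squared step size times 2 from
      \<open>filter_bound\<close>, which also cancels one \<open>c0\<close> and one factor
      k^(-\<alpha>).\<close>
    also have "\<dots> = 8 * c0 * a * real k powr (- \<alpha>) * ?E * (1 / real (k - j + 1))"
      using c0_pos k by (simp add: filter_bound_def power2_eq_square powr_minus del: of_nat_add)
    finally show ?thesis .
  qed
  then have "(\<Sum>j\<in>{k div 2<..k}. (\<eta> j)\<^sup>2 * (real n * filter_bound k j) * ?F j)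
      \<le> (\<Sum>j\<in>{k div 2<..k}. 8 * c0 * a * real k powr (- \<alpha>) * ?E * (1 / real (k - j + 1)))"
    by (rule sum_mono)
  also have "\<dots> = 8 * c0 * a * real k powr (- \<alpha>) * ?E * (\<Sum>j\<in>{k div 2<..k}. 1 / real (k - j + 1))"
    by (simp only: sum_distrib_left)
  also have "\<dots> \<le> 8 * c0 * a * real k powr (- \<alpha>) * ?E * (1 + ln (real k))"
  proof (rule mult_left_mono)
    have "(\<Sum>j\<in>{k div 2<..k}. 1 / real (k - j + 1)) \<le> (\<Sum>j\<in>{1..k}. 1 / real (k - j + 1))"
      by (intro sum_mono2) auto
    also have "\<dots> = (\<Sum>d\<in>{1..k}. 1 / real d)"
      by (rule sum.reindex_bij_witness[of _ "\<lambda>d. k - d + 1" "\<lambda>d. k - d + 1"]) auto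
    also have "\<dots> \<le> 1 + ln (real k)"
      using k by (rule sum_inverse_le_ln)
    finally show "(\<Sum>j\<in>{k div 2<..k}. 1 / real (k - j + 1)) \<le> 1 + ln (real k)" .
    show "0 \<le> 8 * c0 * a * real k powr (- \<alpha>) * ?E"
      using E0 c0_pos a0 by simp
  qed
  finally show ?thesis
    by (simp add: mult_ac)
qed

lemma energy_recursion:
  assumes k: "1 \<le> k"
  shows "energy \<eta> z k \<le> 5 * D * real k powr (- (q * (1 - \<alpha>)))
    + 8 * c0 * a * real k powr (- \<alpha>) * (1 + ln (real k)) * energy \<eta> z (k div 2)"
proof (cases "real n \<le> real k powr (1 - \<alpha>)")
  case True
  let ?G = "\<lambda>j. (\<eta> j)\<^sup>2 * (real n * filter_bound k j) * weighted_energy \<eta> z (j - 1) lam"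
  have split: "{0<..k} = {1..k div 2} \<union> {k div 2<..k}"
    by auto
  have "energy \<eta> z k
      \<le> weighted_energy \<eta> z 0 (\<lambda>l. \<Prod>i\<in>{0<..k}. (1 - \<eta> i * lam l)\<^sup>2) + sum ?G {0<..k}"
    by (intro energy_unroll filter_bound filter_bound_nonneg) auto
  also have "sum ?G {0<..k} = sum ?G {1..k div 2} + sum ?G {k div 2<..k}"
    unfolding split by (intro sum.union_disjoint) auto
  \<comment> \<open>The 5 is 1 from the bias plus 4 from the early steps.\<close>
  finally show ?thesis
    using bias_le[OF k] early_le[OF k True] late_le[OF k] by linarith
next
  case False
  let ?R = "8 * c0 * a * real k powr (- \<alpha>) * (1 + ln (real k)) * energy \<eta> z (k div 2)"
  have "0 \<le> ?R"
    using c0_pos a0 k by (intro mult_nonneg_nonneg weighted_energy_nonneg) auto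
  moreover have "energy \<eta> z k \<le> D * real k powr (- (q * (1 - \<alpha>)))"
  proof -
    \<comment> \<open>Now \<open>n\<close> exceeds k^(1-\<alpha>), so the initial bound is already
      as small as the claimed rate.\<close>
    have "real n powr (- q) \<le> (real k powr (1 - \<alpha>)) powr (- q)"
      using False k q_bounds by (intro powr_mono2') auto
    also have "\<dots> = real k powr (- (q * (1 - \<alpha>)))"
      by (simp only: powr_powr) (simp add: algebra_simps)
    finally have "D * real n powr (- q) \<le> D * real k powr (- (q * (1 - \<alpha>)))"
      using source_const_nonneg by (rule mult_left_mono)
    then show ?thesis
      using initial_energy_le energy_antimono[of \<eta> 0 k z, OF \<eta>_bounds] by linarith
  qed
  moreover have "0 \<le> D * real k powr (- (q * (1 - \<alpha>)))"
    using source_const_nonneg by simp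
  ultimately show ?thesis
    by linarith
qed

lemma energy_rate:
  assumes k: "2 \<le> k"
  shows "energy \<eta> z k \<le> rate_const p \<omega> a c0
    * real k powr (- min (2 * \<alpha>) (q * (1 - \<alpha>))) * (ln (real k))\<^sup>2"
proof -
  define \<beta> where "\<beta> = q * (1 - \<alpha>)"
  define L where "L = 1 + ln (real k)"
  define r where "r = real k powr (- min (2 * \<alpha>) \<beta>)"
  have \<beta>: "0 \<le> \<beta>" "\<beta> \<le> 1"
    using q_bounds \<alpha> mult_mono[of q 1 "1 - \<alpha>" 1] by (auto simp: \<beta>_def)
  define H where "H = 8 * c0 * a"
  have H: "0 \<le> H"
    using c0_pos a0 by (simp add: H_def)
  have L: "1 \<le> L"
    using k by (simp add: L_def)
  define j where "j = k div 2"
  \<comment> \<open>The worst case is \<open>k = 3\<close>; this is the origin of the constant 3 in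
    \<open>shift\<close>.\<close>
  have "k \<le> 3 * (k div 2)"
    using k by presburger
  then have j: "1 \<le> j" "real k / 3 \<le> real j" "j \<le> k" "j div 2 \<le> j"
    using k by (auto simp: j_def)
  have shift: "real j powr (- s) \<le> 3 * real k powr (- s)" if s: "0 \<le> s" "s \<le> 1" for s
  proof -
    have "real j powr (- s) \<le> (real k * (1 / 3)) powr (- s)"
      using j k s by (intro powr_mono2') auto
    also have "\<dots> = real k powr (- s) * 3 powr s"
      using k by (subst powr_mult) (auto simp: powr_divide powr_minus_divide)
    also have "\<dots> \<le> real k powr (- s) * 3"
      using s powr_mono[of s 1 3] by (intro mult_left_mono) auto
    finally show ?thesis
      by simp
  qed
  have E0: "energy \<eta> z i \<le> D" for i
    using energy_antimono[of \<eta> 0 i z, OF \<eta>_bounds] initial_energy_le_const by simp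
  \<comment> \<open>First use of the recursion, at \<open>j = k div 2\<close>; the energy at
    \<open>j div 2\<close> is bounded by \<open>D\<close>.\<close>
  have "energy \<eta> z j
      \<le> 5 * D * real j powr (- \<beta>) + H * real j powr (- \<alpha>) * (1 + ln (real j)) * energy \<eta> z (j div 2)"
    using energy_recursion[OF j(1)] by (simp add: \<beta>_def H_def)
  also have "\<dots> \<le> 5 * D * (3 * real k powr (- \<beta>)) + H * (3 * real k powr (- \<alpha>)) * L * D"
    using j source_const_nonneg H \<beta> \<alpha> L unfolding L_def
    by (intro add_mono mult_mono mult_left_mono shift E0 weighted_energy_nonneg mult_nonneg_nonneg)
      auto
  finally have Ej: "energy \<eta> z j \<le> 15 * D * real k powr (- \<beta>) + 3 * H * D * real k powr (- \<alpha>) * L"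
    by (simp add: mult_ac)
  have r1: "real k powr (- \<beta>) \<le> r"
    using k by (simp add: r_def)
  have r2: "real k powr (- \<alpha>) * real k powr (- \<alpha>) \<le> r"
    using k by (simp add: r_def powr_add[symmetric])
  have ka: "real k powr (- \<alpha>) \<le> 1"
    using k \<alpha> powr_mono[of "- \<alpha>" 0 "real k"] by auto
  have r0: "0 \<le> r"
    by (simp add: r_def)
  have LL: "1 \<le> L * L" "L \<le> L * L"
    using L mult_mono[of 1 L 1 L] by auto
  \<comment> \<open>Second use, at \<open>k\<close>. Inserting the bound for \<open>j\<close> yields
    the products k^(-\<beta>), k^(-\<alpha>-\<beta>) L and k^(-2\<alpha>) L^2, each at most r
    L^2.\<close>
  have "energy \<eta> z k \<le> 5 * D * real k powr (- \<beta>) + H * real k powr (- \<alpha>) * L * energy \<eta> z j"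
    using energy_recursion[of k] k by (simp add: \<beta>_def H_def L_def j_def)
  also have "\<dots> \<le> 5 * D * real k powr (- \<beta>) + H * real k powr (- \<alpha>) * L
      * (15 * D * real k powr (- \<beta>) + 3 * H * D * real k powr (- \<alpha>) * L)"
    using H L Ej by (intro add_left_mono mult_left_mono) auto
  also have "\<dots> = 5 * D * (real k powr (- \<beta>) * 1)
      + 15 * H * D * (real k powr (- \<beta>) * (real k powr (- \<alpha>) * L))
      + 3 * H\<^sup>2 * D * (real k powr (- \<alpha>) * real k powr (- \<alpha>) * (L * L))"
    by (simp add: power2_eq_square algebra_simps)
  also have "\<dots> \<le> 5 * D * (r * (L * L)) + 15 * H * D * (r * (L * L)) + 3 * H\<^sup>2 * D * (r * (L * L))"
  proof (intro add_mono mult_left_mono)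
    show "real k powr (- \<beta>) * 1 \<le> r * (L * L)"
      using r1 r0 LL by (intro mult_mono) auto
    have "real k powr (- \<alpha>) * L \<le> 1 * (L * L)"
      using ka L LL by (intro mult_mono) auto
    then show "real k powr (- \<beta>) * (real k powr (- \<alpha>) * L) \<le> r * (L * L)"
      using r1 r0 L by (intro mult_mono) auto
    show "real k powr (- \<alpha>) * real k powr (- \<alpha>) * (L * L) \<le> r * (L * L)"
      using r2 LL by (intro mult_right_mono) auto
  qed (use source_const_nonneg H in auto)
  also have "\<dots> = (5 * D + 15 * H * D + 3 * H\<^sup>2 * D) * r * (L * L)"
    by (simp add: algebra_simps)
  also have "\<dots> \<le> (5 * D + 15 * H * D + 3 * H\<^sup>2 * D) * r * (9 * (ln (real k))\<^sup>2)"
  proof (intro mult_left_mono)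
    \<comment> \<open>For \<open>k \<ge> 2\<close> this gives 1 <= 2 ln k, hence L <= 3 ln
      k.\<close>
    have "1 / 2 \<le> ln (2::real)"
      using ln_le_minus_one[of "1 / 2"] by (simp add: ln_div)
    also have "\<dots> \<le> ln (real k)"
      using k by simp
    finally have "L \<le> 3 * ln (real k)"
      by (simp add: L_def)
    then have "L * L \<le> (3 * ln (real k)) * (3 * ln (real k))"
      using L by (intro mult_mono) auto
    then show "L * L \<le> 9 * (ln (real k))\<^sup>2"
      by (simp add: power2_eq_square)
  qed (use source_const_nonneg H r0 in auto)
  finally show ?thesis
    unfolding r_def \<beta>_def rate_const_def Let_def H_def by (simp only: mult_ac)
qed

end

end

section \<open>Spectral decomposition of symmetric real matrices\<close>

lemma mult_mat_vec_index:
  assumes "A \<in> carrier_mat n m" "x \<in> carrier_vec m" "i < n"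
  shows "(A *\<^sub>v x) $ i = (\<Sum>j<m. A $$ (i, j) * x $ j)"
  using assms by (auto simp: scalar_prod_def atLeast0LessThan intro!: sum.cong)

text \<open>A complex eigenvector u + i w exists because the spectrum is nonempty. Symmetry makes
  its eigenvalue real, and then whichever of u and w is nonzero is a real eigenvector.\<close>

lemma symmetric_real_eigenvector:
  fixes A :: "real Matrix.mat"
  assumes A: "A \<in> carrier_mat n n" and sym: "transpose_mat A = A" and n: "0 < n"
  shows "\<exists>v e. v \<in> carrier_vec n \<and> scalar_prod v v = 1 \<and> A *\<^sub>v v = e \<cdot>\<^sub>v v"
proof -
  let ?C = "map_mat complex_of_real A"
  have C: "?C \<in> carrier_mat n n"
    using A by simp
  obtain e where "eigenvalue ?C e"
    using spectrum_non_empty[OF C n] unfolding spectrum_def by auto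
  then obtain x where x: "x \<in> carrier_vec n" "x \<noteq> 0\<^sub>v n" "?C *\<^sub>v x = e \<cdot>\<^sub>v x"
    using C unfolding eigenvalue_def eigenvector_def by auto
  define u where "u i = Re (x $ i)" for i
  define w where "w i = Im (x $ i)" for i
  have ev: "(\<Sum>j<n. complex_of_real (A $$ (i, j)) * x $ j) = e * x $ i" if i: "i < n" for i
  proof -
    have "(\<Sum>j<n. complex_of_real (A $$ (i, j)) * x $ j) = (?C *\<^sub>v x) $ i"
      using mult_mat_vec_index[OF C x(1) i] A i by simp
    then show ?thesis
      using x i by simp
  qed
  have u: "(\<Sum>j<n. A $$ (i, j) * u j) = Re e * u i - Im e * w i"
    and w: "(\<Sum>j<n. A $$ (i, j) * w j) = Re e * w i + Im e * u i" if i: "i < n" for i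
    using arg_cong[OF ev[OF i], of Re] arg_cong[OF ev[OF i], of Im]
    by (simp_all add: u_def w_def Re_sum Im_sum)
  \<comment> \<open>Symmetry equates (w, A u) with (u, A w); the eigenvalue equations then leave Im
    e (|u|^2 + |w|^2) = 0.\<close>
  have "(\<Sum>i<n. w i * (\<Sum>j<n. A $$ (i, j) * u j)) = (\<Sum>j<n. u j * (\<Sum>i<n. A $$ (i, j) * w i))"
    unfolding sum_distrib_left by (subst sum.swap) (simp add: mult_ac)
  also have "\<dots> = (\<Sum>j<n. u j * (\<Sum>i<n. A $$ (j, i) * w i))"
  proof (intro sum.cong refl arg_cong2[of _ _ _ _ "(*)"])
    fix i j assume "j \<in> {..<n}" "i \<in> {..<n}"
    then show "A $$ (i, j) = A $$ (j, i)"
      using arg_cong[OF sym, of "\<lambda>B. B $$ (j, i)"] A by simp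
  qed
  finally have "(\<Sum>i<n. w i * (Re e * u i - Im e * w i)) = (\<Sum>i<n. u i * (Re e * w i + Im e * u i))"
    by (simp add: u w)
  then have "Im e * (\<Sum>i<n. (u i)\<^sup>2 + (w i)\<^sup>2) = 0"
    by (simp add: algebra_simps sum.distrib sum_subtractf sum_distrib_left power2_eq_square)
  moreover obtain i0 where i0: "i0 < n" "x $ i0 \<noteq> 0"
  proof -
    have "\<exists>i<n. x $ i \<noteq> 0"
    proof (rule ccontr)
      assume "\<not> ?thesis"
      then have "x = 0\<^sub>v n"
        using x(1) by (intro eq_vecI) auto
      then show False
        using x(2) by simp
    qed
    then show ?thesis
      using that by blast
  qed
  moreover have "0 < (\<Sum>i<n. (u i)\<^sup>2 + (w i)\<^sup>2)"
  proof (rule sum_pos2[of _ i0])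
    show "0 < (u i0)\<^sup>2 + (w i0)\<^sup>2"
      using i0(2) by (auto simp: u_def w_def complex_eq_iff sum_power2_gt_zero_iff)
  qed (use i0 in auto)
  ultimately have e: "Im e = 0"
    by simp
  define y where "y = (if u i0 \<noteq> 0 then u else w)"
  have y0: "y i0 \<noteq> 0"
    using i0(2) by (auto simp: y_def u_def w_def complex_eq_iff)
  have y: "(\<Sum>j<n. A $$ (i, j) * y j) = Re e * y i" if "i < n" for i
    using u[OF that] w[OF that] e by (simp add: y_def)
  define s where "s = (\<Sum>j<n. (y j)\<^sup>2)"
  have s: "0 < s"
    unfolding s_def by (rule sum_pos2[of _ i0]) (use i0 y0 in auto)
  define v where "v = Matrix.vec n (\<lambda>j. y j / sqrt s)"
  have v: "v \<in> carrier_vec n"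
    by (simp add: v_def)
  have "scalar_prod v v = (\<Sum>j<n. (y j)\<^sup>2 / s)"
    using s by (auto simp: scalar_prod_def v_def atLeast0LessThan power2_eq_square intro!: sum.cong)
  also have "\<dots> = 1"
    using s by (simp add: sum_divide_distrib[symmetric] s_def)
  finally have "scalar_prod v v = 1" .
  moreover have "A *\<^sub>v v = Re e \<cdot>\<^sub>v v"
  proof (rule eq_vecI)
    fix i assume "i < dim_vec (Re e \<cdot>\<^sub>v v)"
    then have i: "i < n"
      by (simp add: v_def)
    have "(A *\<^sub>v v) $ i = (\<Sum>j<n. A $$ (i, j) * y j) / sqrt s"
      unfolding mult_mat_vec_index[OF A v i] by (simp add: v_def sum_divide_distrib)
    then show "(A *\<^sub>v v) $ i = (Re e \<cdot>\<^sub>v v) $ i"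
      using i y[OF i] by (simp add: v_def)
  qed (use A in \<open>simp add: v_def\<close>)
  ultimately show ?thesis
    using v by blast
qed

text \<open>The Householder reflection; when \<open>v\<close> is the unit vector, \<open>2 / 0 = 0\<close> makes it the identity.\<close>

lemma householder_exists:
  fixes v :: "real Matrix.vec"
  assumes v: "v \<in> carrier_vec n" "scalar_prod v v = 1" and n: "0 < n"
  shows "\<exists>H. H \<in> carrier_mat n n \<and> transpose_mat H = H \<and> H * H = 1\<^sub>m n \<and>
    H *\<^sub>v unit_vec n 0 = v"
proof -
  define z where "z i = v $ i - (if i = 0 then 1 else 0)" for i
  define s where "s = (\<Sum>i<n. (z i)\<^sup>2)"
  define c where "c = 2 / s"
  define H where "H = Matrix.mat n n (\<lambda>(i, j). (if i = j then 1 else 0) - c * z i * z j)"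
  have H: "H \<in> carrier_mat n n"
    by (simp add: H_def)
  \<comment> \<open>This also holds for s = 0, where c = 0; it makes \<open>H\<close> an
    involution.\<close>
  have cs: "c * c * s = 2 * c"
    by (simp add: c_def)
  have "H * H = 1\<^sub>m n"
  proof (rule eq_matI)
    fix i j assume "i < dim_row (1\<^sub>m n)" "j < dim_col (1\<^sub>m n)"
    then have ij: "i < n" "j < n"
      by auto
    have "(H * H) $$ (i, j) = (\<Sum>k<n. ((if i = k then 1 else 0) - c * z i * z k)
        * ((if k = j then 1 else 0) - c * z k * z j))"
      using ij by (simp add: H_def scalar_prod_def atLeast0LessThan)
    also have "\<dots> = (\<Sum>k<n. (if k = i then (if i = j then 1 else 0) - c * z i * z j else 0)
        - (if k = j then c * z i * z j else 0) + c * c * z i * z j * (z k)\<^sup>2)"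
      by (intro sum.cong refl) (auto simp: algebra_simps power2_eq_square)
    also have "\<dots> = (if i = j then 1 else 0) - 2 * c * z i * z j + (c * c * s) * z i * z j"
      using ij by (simp add: sum.distrib sum_subtractf sum_distrib_left[symmetric] s_def)
    finally show "(H * H) $$ (i, j) = 1\<^sub>m n $$ (i, j)"
      using ij unfolding cs by simp
  qed (use H in auto)
  moreover have "transpose_mat H = H"
    by (rule eq_matI) (auto simp: H_def)
  moreover have "H *\<^sub>v unit_vec n 0 = v"
  proof (rule eq_vecI)
    fix i assume "i < dim_vec v"
    then have i: "i < n"
      using v by simp
    have "(H *\<^sub>v unit_vec n 0) $ i = H $$ (i, 0)"
      using i n H by simp
    also have "\<dots> = (if i = 0 then 1 else 0) - c * z i * z 0"
      using i n by (simp add: H_def)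
    also have "\<dots> = v $ i"
    proof (cases "z i = 0")
      case True
      then show ?thesis
        by (simp add: z_def split: if_splits)
    next
      case False
      have "0 < s"
        unfolding s_def by (rule sum_pos2[of _ i]) (use i False in auto)
      \<comment> \<open>As |v| = 1, \<open>s\<close> equals 2 - 2 v_0 = -2 z_0, so c z_0 = -1 and
        column 0 of \<open>H\<close> is \<open>v\<close>.\<close>
      have "s = (\<Sum>i<n. (v $ i)\<^sup>2 + (if i = 0 then 1 - 2 * v $ 0 else 0))"
        unfolding s_def z_def by (intro sum.cong refl) (auto simp: power2_eq_square algebra_simps)
      also have "\<dots> = (\<Sum>i<n. (v $ i)\<^sup>2) + (1 - 2 * v $ 0)"
        using n by (simp add: sum.distrib)
      also have "(\<Sum>i<n. (v $ i)\<^sup>2) = 1"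
        using v by (simp add: scalar_prod_def atLeast0LessThan power2_eq_square)
      finally have "s = - 2 * z 0"
        by (simp add: z_def)
      then have "c * z 0 = - 1"
        using \<open>0 < s\<close> by (simp add: c_def field_simps)
      then have "c * z i * z 0 = - z i"
        by (metis mult.assoc mult.commute mult_minus1)
      then show ?thesis
        by (simp add: z_def)
    qed
    finally show "(H *\<^sub>v unit_vec n 0) $ i = v $ i" .
  qed (use v H in auto)
  ultimately show ?thesis
    using H by blast
qed

text \<open>Induction by deflation: a reflection moves a unit eigenvector onto the first basis
  vector, and symmetry then splits off a 1 by 1 block.\<close>

theorem symmetric_mat_diagonalizable:
  fixes A :: "real Matrix.mat"
  assumes "A \<in> carrier_mat n n" "transpose_mat A = A"
  shows "\<exists>Q d. Q \<in> carrier_mat n n \<and> transpose_mat Q * Q = 1\<^sub>m n \<and>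
    A = Q * mat_diag n d * transpose_mat Q"
  using assms
proof (induction n arbitrary: A)
  case 0
  then show ?case
    by (intro exI[of _ "1\<^sub>m 0"] exI[of _ "\<lambda>_. 0"]) (auto intro!: eq_matI)
next
  case (Suc n A)
  let ?N = "Suc n"
  note A = Suc.prems(1)
  obtain v e where v: "v \<in> carrier_vec ?N" "scalar_prod v v = 1" and ev: "A *\<^sub>v v = e \<cdot>\<^sub>v v"
    using symmetric_real_eigenvector[OF Suc.prems] by auto
  obtain H where H: "H \<in> carrier_mat ?N ?N" "transpose_mat H = H" "H * H = 1\<^sub>m ?N"
      and Hv: "H *\<^sub>v unit_vec ?N 0 = v"
    using householder_exists[OF v] by auto
  define A' where "A' = H * A * H"
  have A': "A' \<in> carrier_mat ?N ?N"
    using H A by (simp add: A'_def)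
  have A'T: "transpose_mat A' = A'"
    unfolding A'_def using H(1,2) A Suc.prems(2)
    by (simp add: transpose_mult[of _ ?N ?N _ ?N])
  have AH: "A = H * A' * H"
  proof -
    have "H * A' * H = (H * H) * A * (H * H)"
      unfolding A'_def using H(1) A by (simp add: assoc_mult_mat[of _ ?N ?N _ ?N _ ?N])
    then show ?thesis
      using A by (simp add: H(3))
  qed
  have "H *\<^sub>v v = unit_vec ?N 0"
    unfolding Hv[symmetric] using H
    by (subst assoc_mult_mat_vec[symmetric, of _ ?N ?N _ ?N]) auto
  then have A'e: "A' *\<^sub>v unit_vec ?N 0 = e \<cdot>\<^sub>v unit_vec ?N 0"
    unfolding A'_def using H(1) A v(1)
    by (simp add: assoc_mult_mat_vec[of _ ?N ?N _ ?N] Hv ev mult_mat_vec)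
  have col0: "A' $$ (i, 0) = (if i = 0 then e else 0)" if "i < ?N" for i
  proof -
    have "A' $$ (i, 0) = (A' *\<^sub>v unit_vec ?N 0) $ i"
      using that A' by simp
    then show ?thesis
      using that unfolding A'e by simp
  qed
  have row0: "A' $$ (0, i) = (if i = 0 then e else 0)" if "i < ?N" for i
    using col0[OF that] arg_cong[OF A'T, of "\<lambda>B. B $$ (i, 0)"] A' that by simp
  define A3 where "A3 = Matrix.mat n n (\<lambda>(i, j). A' $$ (Suc i, Suc j))"
  have A3: "A3 \<in> carrier_mat n n"
    by (simp add: A3_def)
  have "transpose_mat A3 = A3"
  proof (rule eq_matI)
    fix i j assume "i < dim_row A3" "j < dim_col A3"
    then show "transpose_mat A3 $$ (i, j) = A3 $$ (i, j)"
      using arg_cong[OF A'T, of "\<lambda>B. B $$ (Suc i, Suc j)"] A' by (simp add: A3_def)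
  qed (auto simp: A3_def)
  then obtain Q3 d3 where Q3: "Q3 \<in> carrier_mat n n" "transpose_mat Q3 * Q3 = 1\<^sub>m n"
      and A3Q: "A3 = Q3 * mat_diag n d3 * transpose_mat Q3"
    using Suc.IH[OF A3] by blast
  let ?b = "\<lambda>X Y. four_block_mat X (0\<^sub>m 1 n) (0\<^sub>m n 1) Y"
  \<comment> \<open>Bordering \<open>Q3\<close> by 1 diagonalizes \<open>A'\<close>;
    \<open>case_nat\<close> puts \<open>e\<close> in front of the smaller spectrum.\<close>
  define R where "R = ?b (1\<^sub>m 1) Q3"
  define d where "d = case_nat e d3"
  have block_mult: "?b X1 Y1 * ?b X2 Y2 = ?b (X1 * X2) (Y1 * Y2)"
    if "X1 \<in> carrier_mat 1 1" "X2 \<in> carrier_mat 1 1" "Y1 \<in> carrier_mat n n" "Y2 \<in> carrier_mat n n"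
    for X1 X2 Y1 Y2 :: "real Matrix.mat"
    using that by (subst mult_four_block_mat[of _ 1 1 _ n _ n _ _ 1 _ n]) auto
  have R: "R \<in> carrier_mat ?N ?N"
    using four_block_carrier_mat[of "1\<^sub>m 1" 1 1 Q3 n n] Q3(1) by (simp add: R_def)
  have RT: "transpose_mat R = ?b (1\<^sub>m 1) (transpose_mat Q3)"
    unfolding R_def using Q3(1) by (subst transpose_four_block_mat[of _ 1 1 _ n _ n]) auto
  have RR: "transpose_mat R * R = 1\<^sub>m ?N"
    unfolding RT unfolding R_def using Q3 by (subst block_mult) auto
  have diag: "mat_diag ?N d = ?b (mat_diag 1 (\<lambda>_. e)) (mat_diag n d3)"
    by (rule eq_matI) (auto simp: mat_diag_def d_def split: nat.split)
  have "A' = ?b (mat_diag 1 (\<lambda>_. e)) A3"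
  proof (rule eq_matI)
    fix i j assume "i < dim_row (?b (mat_diag 1 (\<lambda>_. e)) A3)" "j < dim_col (?b (mat_diag 1 (\<lambda>_. e)) A3)"
    then have "i < ?N" "j < ?N"
      by (simp_all add: A3_def mat_diag_def)
    then show "A' $$ (i, j) = ?b (mat_diag 1 (\<lambda>_. e)) A3 $$ (i, j)"
      using col0[of i] row0[of j] by (cases i; cases j) (auto simp: A3_def mat_diag_def)
  qed (use A' in \<open>auto simp: A3_def mat_diag_def\<close>)
  also have "\<dots> = R * mat_diag ?N d * transpose_mat R"
  proof -
    have RD: "R * mat_diag ?N d = ?b (mat_diag 1 (\<lambda>_. e)) (Q3 * mat_diag n d3)"
      unfolding diag unfolding R_def using Q3(1)
      by (subst block_mult) (auto simp: left_mult_one_mat[of _ "Suc 0" "Suc 0"])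
    show ?thesis
      unfolding RD RT A3Q using Q3(1)
      by (subst block_mult) (auto simp: right_mult_one_mat[of _ "Suc 0" "Suc 0"])
  qed
  finally have A'R: "A' = R * mat_diag ?N d * transpose_mat R" .
  define Q where "Q = H * R"
  have Q: "Q \<in> carrier_mat ?N ?N"
    using H(1) R by (simp add: Q_def)
  have QT: "transpose_mat Q = transpose_mat R * H"
    unfolding Q_def using H(1,2) R by (simp add: transpose_mult[of _ ?N ?N _ ?N])
  have RT_c: "transpose_mat R \<in> carrier_mat ?N ?N"
    using R by simp
  have "transpose_mat Q * Q = transpose_mat R * (H * H) * R"
    unfolding QT unfolding Q_def using H(1) R RT_c
    by (simp add: assoc_mult_mat[of _ ?N ?N _ ?N _ ?N])
  then have "transpose_mat Q * Q = 1\<^sub>m ?N"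
    using RR RT_c by (simp add: H(3))
  moreover have "A = Q * mat_diag ?N d * transpose_mat Q"
  proof -
    have D: "mat_diag ?N d \<in> carrier_mat ?N ?N"
      by simp
    have "A = H * (R * mat_diag ?N d * transpose_mat R) * H"
      using AH A'R by simp
    also have "\<dots> = (H * R) * mat_diag ?N d * (transpose_mat R * H)"
      using H(1) R RT_c D by (simp add: assoc_mult_mat[of _ ?N ?N _ ?N _ ?N] del: mat_diag_dim)
    finally show ?thesis
      unfolding QT unfolding Q_def .
  qed
  ultimately show ?case
    using Q by blast
qed

text \<open>The point is uniqueness in the definite description: two decompositions of
  \<open>B\<close> must give the same power. They are compared through U = P^T Q, which intertwines
  the two diagonal matrices.\<close>

lemma mat_fpow_eq:
  assumes Q: "Q \<in> carrier_mat n n" "transpose_mat Q * Q = 1\<^sub>m n"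
    and B: "B = Q * mat_diag n d * transpose_mat Q"
  shows "mat_fpow B p = Q * mat_diag n (\<lambda>i. rpow (d i) p) * transpose_mat Q"
proof -
  have dim: "dim_row B = n"
    using Q(1) by (simp add: B)
  have "C = Q * mat_diag n (\<lambda>i. rpow (d i) p) * transpose_mat Q"
    if P: "P \<in> carrier_mat n n" "transpose_mat P * P = 1\<^sub>m n"
      and BP: "B = P * mat_diag n f * transpose_mat P"
      and C: "C = P * mat_diag n (\<lambda>i. rpow (f i) p) * transpose_mat P" for C P f
  proof -
    define U where "U = transpose_mat P * Q"
    let ?D = "\<lambda>g. mat_diag n g :: real Matrix.mat"
    have T: "transpose_mat P \<in> carrier_mat n n" "transpose_mat Q \<in> carrier_mat n n"
      using P(1) Q(1) by auto
    have U: "U \<in> carrier_mat n n"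
      using T Q by (simp add: U_def)
    have PP: "P * transpose_mat P = 1\<^sub>m n" and QQ: "Q * transpose_mat Q = 1\<^sub>m n"
      using mat_mult_left_right_inverse[OF T(1) P(1) P(2)]
        mat_mult_left_right_inverse[OF T(2) Q(1) Q(2)] by auto
    note assoc = assoc_mult_mat[of _ n n _ n _ n] mult_carrier_mat[of _ n n _ n]
    have "?D f * U = ?D f * transpose_mat P * Q"
      using T Q(1) by (simp add: U_def assoc)
    also have "\<dots> = (transpose_mat P * P) * ?D f * transpose_mat P * Q"
      unfolding P(2) by (subst left_mult_one_mat[of _ n n]) auto
    also have "\<dots> = transpose_mat P * (P * ?D f * transpose_mat P) * Q"
      using T P(1) Q(1) by (simp add: assoc)
    also have "\<dots> = transpose_mat P * (Q * ?D d * transpose_mat Q) * Q"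
      using B BP by simp
    also have "\<dots> = U * ?D d * (transpose_mat Q * Q)"
      using T P(1) Q(1) by (simp add: assoc U_def)
    also have "\<dots> = U * ?D d"
      unfolding Q(2) using U by (simp add: assoc right_mult_one_mat[of _ n n])
    finally have eq: "?D f * U = U * ?D d" .
    \<comment> \<open>An entry of \<open>U\<close> vanishes unless its two eigenvalues agree, so
      \<open>U\<close> also intertwines any function of the eigenvalues, in particular their
      powers.\<close>
    have entry: "f i * U $$ (i, j) = U $$ (i, j) * d j" if "i < n" "j < n" for i j
      using arg_cong[OF eq, of "\<lambda>B. B $$ (i, j)"] that
      unfolding mat_diag_mult_left[OF U] mat_diag_mult_right[OF U] by simp
    have "?D (\<lambda>i. rpow (f i) p) * U = U * ?D (\<lambda>i. rpow (d i) p)"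
      unfolding mat_diag_mult_left[OF U] mat_diag_mult_right[OF U]
    proof (rule cong_mat)
      fix i j assume "i < n" "j < n"
      then have "U $$ (i, j) = 0 \<or> f i = d j"
        using entry by fastforce
      then show "(case (i, j) of (i, j) \<Rightarrow> rpow (f i) p * U $$ (i, j))
          = (case (i, j) of (i, j) \<Rightarrow> U $$ (i, j) * rpow (d j) p)"
        by auto
    qed auto
    note eq' = this
    have UQ: "U * transpose_mat Q = transpose_mat P" and PU: "P * U = Q"
    proof -
      have "U * transpose_mat Q = transpose_mat P * (Q * transpose_mat Q)"
        using T P(1) Q(1) by (simp add: assoc U_def)
      then show "U * transpose_mat Q = transpose_mat P"
        using T by (simp add: QQ)
      have "P * U = (P * transpose_mat P) * Q"
        using T P(1) Q(1) by (simp add: assoc U_def)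
      then show "P * U = Q"
        using Q by (simp add: PP)
    qed
    have "C = P * ?D (\<lambda>i. rpow (f i) p) * (U * transpose_mat Q)"
      by (simp add: C UQ)
    also have "\<dots> = P * (?D (\<lambda>i. rpow (f i) p) * U) * transpose_mat Q"
      using T P(1) U by (simp add: assoc)
    also have "\<dots> = (P * U) * ?D (\<lambda>i. rpow (d i) p) * transpose_mat Q"
      unfolding eq' using T P(1) U by (simp add: assoc)
    finally show ?thesis
      by (simp add: PU)
  qed
  then show ?thesis
    unfolding mat_fpow_def dim using Q B by (intro the_equality) blast+
qed

section \<open>Expectations over the random indices\<close>

text \<open>Induction on \<open>k\<close>: the last variable has countably many values, and each
  fixed value is stored in \<open>h\<close>, which is therefore arbitrary.\<close>

lemma measurable_finite_dependence:
  fixes X :: "nat \<Rightarrow> 'a \<Rightarrow> 'b :: countable" and F :: "(nat \<Rightarrow> 'b) \<Rightarrow> real"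
  assumes X: "\<And>j. j \<in> {1..k} \<Longrightarrow> X j \<in> measurable M (count_space UNIV)"
  shows "(\<lambda>\<omega>. F (\<lambda>j. if j \<in> {1..k} then X j \<omega> else h j)) \<in> borel_measurable M"
  using X
proof (induction k arbitrary: h)
  case 0
  then show ?case by simp
next
  case (Suc k)
  have eq: "(\<lambda>j. if j \<in> {1..Suc k} then X j \<omega> else h j)
      = (\<lambda>j. if j \<in> {1..k} then X j \<omega> else (h(Suc k := X (Suc k) \<omega>)) j)" for \<omega>
    by (auto simp: fun_eq_iff)
  show ?case
    unfolding eq
    by (rule measurable_compose_countable[where f =
          "\<lambda>i \<omega>. F (\<lambda>j. if j \<in> {1..k} then X j \<omega> else (h(Suc k := i)) j)"])
      (use Suc in auto)
qed

text \<open>Up to a null set the space is the disjoint union of the events that the first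
  \<open>k\<close> indices follow a given path, each of probability n^(-k) by independence.\<close>

lemma expectation_eq_path_mean:
  assumes iid: "iid_uniform M n X" and n: "0 < n"
    and F: "\<And>f g. (\<And>j. j \<in> {1..k} \<Longrightarrow> f j = g j) \<Longrightarrow> F f = F g"
  shows "prob_space.expectation M (\<lambda>\<omega>. F (\<lambda>j. X j \<omega>)) = path_mean n k F"
proof -
  interpret prob_space M
    using iid by (simp add: iid_uniform_def)
  have indep: "indep_vars (\<lambda>_. count_space UNIV) X {1..}"
    and law: "\<And>j. 1 \<le> j \<Longrightarrow> distr M (count_space UNIV) (X j) = measure_pmf (pmf_of_set {..<n})"
    using iid by (auto simp: iid_uniform_def)
  have meas: "X j \<in> measurable M (count_space UNIV)" if "1 \<le> j" for j
    using indep that by (auto simp: indep_vars_def2)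
  have prob_single: "prob (X j -` {a} \<inter> space M) = 1 / real n" if "1 \<le> j" "a < n" for j a
  proof -
    have "prob (X j -` {a} \<inter> space M) = measure (distr M (count_space UNIV) (X j)) {a}"
      using meas[OF that(1)] by (simp add: measure_distr)
    also have "\<dots> = pmf (pmf_of_set {..<n}) a"
      by (simp add: law[OF that(1)] measure_pmf_single)
    also have "\<dots> = 1 / real n"
      using that n by (subst pmf_of_set) (auto simp: indicator_def)
    finally show ?thesis .
  qed
  \<comment> \<open>Only the law of the indices is given, so they lie below \<open>n\<close> almost
    surely.\<close>
  have AE_range: "AE \<omega> in M. \<forall>j\<in>{1..k}. X j \<omega> < n"
  proof (subst AE_ball_countable)
    show "\<forall>j\<in>{1..k}. AE \<omega> in M. X j \<omega> < n"
    proof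
      fix j assume j: "j \<in> {1..k}"
      have "AE i in distr M (count_space UNIV) (X j). i < n"
        using j n by (subst law) (auto simp: AE_measure_pmf_iff lessThan_empty_iff)
      then show "AE \<omega> in M. X j \<omega> < n"
        using meas[of j] j by (subst (asm) AE_distr_iff) auto
    qed
  qed simp
  define Ev where "Ev f = {\<omega> \<in> space M. \<forall>j\<in>{1..k}. X j \<omega> = f j}" for f
  have Ev_sets: "Ev f \<in> sets M" for f
    unfolding Ev_def using meas by measurable
  have prob_Ev: "prob (Ev f) = 1 / real n ^ k" if f: "f \<in> PiE {1..k} (\<lambda>_. {..<n})" for f
  \<comment> \<open>For \<open>k = 0\<close> the intersection below would be the whole type instead
    of \<open>space M\<close>.\<close>
  proof (cases "k = 0")
    case True
    then show ?thesis
      by (simp add: Ev_def prob_space)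
  next
    case False
    have "Ev f = (\<Inter>j\<in>{1..k}. X j -` {f j} \<inter> space M)"
      using False by (auto simp: Ev_def)
    also have "prob \<dots> = (\<Prod>j\<in>{1..k}. prob (X j -` {f j} \<inter> space M))"
      by (rule indep_varsD[OF indep]) (use False in auto)
    also have "\<dots> = (\<Prod>j\<in>{1..k}. 1 / real n)"
      using f by (intro prod.cong refl prob_single) auto
    finally show ?thesis
      by (simp add: power_divide)
  qed
  have "expectation (\<lambda>\<omega>. F (\<lambda>j. X j \<omega>))
      = expectation (\<lambda>\<omega>. \<Sum>f\<in>PiE {1..k} (\<lambda>_. {..<n}). F f * indicator (Ev f) \<omega>)"
  proof (rule integral_cong_AE)
    \<comment> \<open>Values beyond \<open>k\<close> are set to 0 to match
      \<open>measurable_finite_dependence\<close>.\<close>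
    have "F (\<lambda>j. X j \<omega>) = F (\<lambda>j. if j \<in> {1..k} then X j \<omega> else 0)" for \<omega>
      by (rule F) simp
    then show "(\<lambda>\<omega>. F (\<lambda>j. X j \<omega>)) \<in> borel_measurable M"
      using measurable_finite_dependence[of k X M F "\<lambda>_. 0"] meas by simp
    show "(\<lambda>\<omega>. \<Sum>f\<in>PiE {1..k} (\<lambda>_. {..<n}). F f * indicator (Ev f) \<omega>) \<in> borel_measurable M"
      using Ev_sets by measurable
    show "AE \<omega> in M. F (\<lambda>j. X j \<omega>) = (\<Sum>f\<in>PiE {1..k} (\<lambda>_. {..<n}). F f * indicator (Ev f) \<omega>)"
      using AE_range
    proof (rule AE_mp, intro AE_I2 impI)
      fix \<omega> assume \<omega>: "\<omega> \<in> space M" "\<forall>j\<in>{1..k}. X j \<omega> < n"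
      \<comment> \<open>The only path in the sum whose event contains
        \<open>\<omega>\<close>.\<close>
      define f0 where "f0 = restrict (\<lambda>j. X j \<omega>) {1..k}"
      have f0: "f0 \<in> PiE {1..k} (\<lambda>_. {..<n})"
        using \<omega> by (auto simp: f0_def)
      have "(\<Sum>f\<in>PiE {1..k} (\<lambda>_. {..<n}). F f * indicator (Ev f) \<omega>)
          = (\<Sum>f\<in>PiE {1..k} (\<lambda>_. {..<n}). if f = f0 then F f0 else 0)"
      proof (intro sum.cong refl)
        fix f assume f: "f \<in> PiE {1..k} (\<lambda>_. {..<n})"
        have "\<omega> \<in> Ev f \<longleftrightarrow> f = f0"
        proof
          assume "\<omega> \<in> Ev f"
          then show "f = f0"
            using f f0 by (intro PiE_ext[OF f f0]) (auto simp: Ev_def f0_def)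
        qed (use \<omega> in \<open>auto simp: Ev_def f0_def\<close>)
        then show "F f * indicator (Ev f) \<omega> = (if f = f0 then F f0 else 0)"
          by auto
      qed
      also have "\<dots> = F f0"
        using f0 by (simp add: finite_PiE)
      also have "\<dots> = F (\<lambda>j. X j \<omega>)"
        by (rule F) (simp add: f0_def)
      finally show "F (\<lambda>j. X j \<omega>) = (\<Sum>f\<in>PiE {1..k} (\<lambda>_. {..<n}). F f * indicator (Ev f) \<omega>)"
        by simp
    qed
  qed
  also have "\<dots> = (\<Sum>f\<in>PiE {1..k} (\<lambda>_. {..<n}). F f * prob (Ev f))"
    using Ev_sets by (subst Bochner_Integration.integral_sum) (auto simp: emeasure_eq_measure)
  also have "\<dots> = (\<Sum>f\<in>PiE {1..k} (\<lambda>_. {..<n}). F f * (1 / real n ^ k))"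
    by (intro sum.cong refl) (use prob_Ev in simp)
  finally show ?thesis
    by (simp add: path_mean_def sum_divide_distrib)
qed

section \<open>The error estimate\<close>

lemma vnorm_sq: "(vnorm v)\<^sup>2 = (\<Sum>l<dim_vec v. (v $ l)\<^sup>2)"
  by (simp add: vnorm_def scalar_prod_def atLeast0LessThan power2_eq_square sum_nonneg)

lemma vnorm_nonneg: "0 \<le> vnorm v"
  by (simp add: vnorm_def scalar_prod_def sum_nonneg)

lemma scalar_prod_orthogonal:
  fixes Q :: "real Matrix.mat"
  assumes Q: "Q \<in> carrier_mat m m" "Q * transpose_mat Q = 1\<^sub>m m"
    and x: "x \<in> carrier_vec m" and y: "y \<in> carrier_vec m"
  shows "scalar_prod (transpose_mat Q *\<^sub>v x) (transpose_mat Q *\<^sub>v y) = scalar_prod x y"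
proof -
  have "scalar_prod (transpose_mat Q *\<^sub>v x) (transpose_mat Q *\<^sub>v y)
      = scalar_prod x (Q *\<^sub>v (transpose_mat Q *\<^sub>v y))"
    using Q x y by (intro transpose_vec_mult_scalar[of _ m m]) auto
  also have "Q *\<^sub>v (transpose_mat Q *\<^sub>v y) = y"
    using Q y by (subst assoc_mult_mat_vec[symmetric, of _ m m _ m]) auto
  finally show ?thesis .
qed

text \<open>The supremum has to range over a bounded set; Cauchy-Schwarz in each row gives the
  Frobenius norm as a bound.\<close>

lemma vnorm_mult_le_spectral_norm:
  assumes A: "A \<in> carrier_mat n m" and x: "x \<in> carrier_vec m" "vnorm x \<le> 1"
  shows "vnorm (A *\<^sub>v x) \<le> spectral_norm A"
proof -
  have "bdd_above ((\<lambda>x. vnorm (A *\<^sub>v x)) ` {x \<in> carrier_vec (dim_col A). vnorm x \<le> 1})"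
  proof (rule bdd_aboveI2)
    fix y assume "y \<in> {x \<in> carrier_vec (dim_col A). vnorm x \<le> 1}"
    then have y: "y \<in> carrier_vec m" "vnorm y \<le> 1"
      using A by auto
    have "(vnorm (A *\<^sub>v y))\<^sup>2 = (\<Sum>i<n. (\<Sum>j<m. A $$ (i, j) * y $ j)\<^sup>2)"
      using A y by (simp add: vnorm_sq mult_mat_vec_index[of A n m] del: index_mult_mat_vec)
    also have "\<dots> \<le> (\<Sum>i<n. (\<Sum>j<m. (A $$ (i, j))\<^sup>2) * 1)"
    proof (intro sum_mono)
      fix i
      have "(\<Sum>j<m. A $$ (i, j) * y $ j)\<^sup>2 \<le> (\<Sum>j<m. (A $$ (i, j))\<^sup>2) * (\<Sum>j<m. (y $ j)\<^sup>2)"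
        by (rule Cauchy_Schwarz_ineq_sum)
      also have "\<dots> \<le> (\<Sum>j<m. (A $$ (i, j))\<^sup>2) * 1"
      proof (intro mult_left_mono sum_nonneg)
        show "(\<Sum>j<m. (y $ j)\<^sup>2) \<le> 1"
          using y vnorm_sq[of y] vnorm_nonneg[of y] power_mono[of "vnorm y" 1 2] by simp
      qed auto
      finally show "(\<Sum>j<m. A $$ (i, j) * y $ j)\<^sup>2 \<le> (\<Sum>j<m. (A $$ (i, j))\<^sup>2) * 1" .
    qed
    finally show "vnorm (A *\<^sub>v y) \<le> sqrt (\<Sum>i<n. (\<Sum>j<m. (A $$ (i, j))\<^sup>2) * 1)"
      by (rule real_le_rsqrt)
  qed
  then show ?thesis
    unfolding spectral_norm_def using A x by (intro cSUP_upper) auto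
qed

lemma normal_mat_carrier: "A \<in> carrier_mat n m \<Longrightarrow> normal_mat A \<in> carrier_mat m m"
  by (simp add: normal_mat_def)

lemma normal_mat_symmetric:
  assumes "A \<in> carrier_mat n m"
  shows "transpose_mat (normal_mat A) = normal_mat A"
  by (intro eq_matI) (use assms in \<open>auto simp: normal_mat_def intro: comm_scalar_prod[of _ n]\<close>)

lemma sgd_carrier:
  assumes "A \<in> carrier_mat n m" "x1 \<in> carrier_vec m" "\<And>j. j \<in> {1..k} \<Longrightarrow> f j < n"
  shows "sgd A y \<eta> x1 f (Suc k) \<in> carrier_vec m"
  using assms(3) by (induction k) (use assms(1,2) in \<open>auto simp: Let_def\<close>)

lemma sgd_cong:
  assumes "\<And>j. j \<in> {1..k} \<Longrightarrow> f j = g j"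
  shows "sgd A y \<eta> x1 f (Suc k) = sgd A y \<eta> x1 g (Suc k)"
  using assms by (induction k) (auto simp: Let_def)

text \<open>In an orthonormal eigenbasis of B the rows form a \<open>gram_system\<close> with
  eigenvalues \<open>d\<close>, and the error coordinates follow \<open>iter\<close>; iterate
  \<open>k + 1\<close> has taken \<open>k\<close> steps. The factors 2 come from
  \<open>iter_energy_le\<close>.\<close>

lemma sgd_error_bound:
  fixes A :: "real Matrix.mat"
  assumes n: "0 < n" and A: "A \<in> carrier_mat n m" and x1: "x1 \<in> carrier_vec m"
    and xdag: "xdag \<in> carrier_vec m" "A *\<^sub>v xdag = ydag"
    and \<xi>: "\<xi> \<in> carrier_vec n"
    and iid: "iid_uniform M n X"
    and \<alpha>: "0 < \<alpha>" "\<alpha> < 1" and c0: "0 < c0"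
    and rows: "c0 * Max ((\<lambda>i. (vnorm (Matrix.row A i))\<^sup>2) ` {..<n}) \<le> 1"
    and \<eta>: "\<And>j. 1 \<le> j \<Longrightarrow> \<eta> j = c0 * real j powr (- \<alpha>)"
    and p: "0 \<le> p" and w: "w \<in> carrier_vec m"
    and source: "xdag - x1 = mat_fpow (normal_mat A) p *\<^sub>v w"
    and k: "2 \<le> k"
  shows "prob_space.expectation M
      (\<lambda>\<omega>. (vnorm (sgd A (ydag + \<xi>) \<eta> x1 (\<lambda>j. X j \<omega>) (k + 1) - xdag))\<^sup>2)
    \<le> 2 * rate_const p ((vnorm w)\<^sup>2) ((spectral_norm A)\<^sup>2) c0
        * real k powr (- min (2 * \<alpha>) (min 1 (2 * p) * (1 - \<alpha>))) * (ln (real k))\<^sup>2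
      + 2 * c0 / (1 - \<alpha>) * real k powr (1 - \<alpha>) * (vnorm \<xi> / sqrt (real n))\<^sup>2"
proof -
  obtain Q d where Q: "Q \<in> carrier_mat m m" "transpose_mat Q * Q = 1\<^sub>m m"
      and BQ: "normal_mat A = Q * mat_diag m d * transpose_mat Q"
    using symmetric_mat_diagonalizable[OF normal_mat_carrier[OF A] normal_mat_symmetric[OF A]]
    by blast
  have QT: "transpose_mat Q \<in> carrier_mat m m"
    using Q by simp
  have QQ: "Q * transpose_mat Q = 1\<^sub>m m"
    by (rule mat_mult_left_right_inverse[OF QT Q(1) Q(2)])
  define b where "b i l = (A * Q) $$ (i, l)" for i l
  define coord where "coord x l = (transpose_mat Q *\<^sub>v x) $ l" for x l
  have row_coord: "coord (Matrix.row A i) l = b i l" if "i < n" "l < m" for i l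
    using that A Q by (auto simp: coord_def b_def intro!: comm_scalar_prod[of _ m])
  have prod_coord: "scalar_prod x y = (\<Sum>l<m. coord x l * coord y l)"
    if "x \<in> carrier_vec m" "y \<in> carrier_vec m" for x y
    using scalar_prod_orthogonal[OF Q(1) QQ that] Q that
    by (simp add: scalar_prod_def[of "transpose_mat Q *\<^sub>v x"] coord_def atLeast0LessThan)
  have vnorm_coord: "(vnorm x)\<^sup>2 = (\<Sum>l<m. (coord x l)\<^sup>2)" if "x \<in> carrier_vec m" for x
    using prod_coord[OF that that] that
    by (simp add: vnorm_def power2_eq_square sum_nonneg)
  \<comment> \<open>The Gram matrix of the columns of A Q is n Q^T B Q = n diag(d).\<close>
  have gram: "(\<Sum>i<n. b i l * b i l') = (if l = l' then real n * d l else 0)"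
    if l: "l < m" "l' < m" for l l'
  proof -
    have AT: "transpose_mat A \<in> carrier_mat m n"
      using A by simp
    have AA: "transpose_mat A * A = real n \<cdot>\<^sub>m normal_mat A"
      using A n by (auto simp: normal_mat_def)
    note assoc = assoc_mult_mat[of _ m m _ m _ m] mult_carrier_mat[of _ m m _ m]
    have "(\<Sum>i<n. b i l * b i l') = (transpose_mat (A * Q) * (A * Q)) $$ (l, l')"
      using A Q l by (simp add: b_def scalar_prod_def atLeast0LessThan del: index_mult_mat(1))
        (simp add: scalar_prod_def atLeast0LessThan)
    also have "transpose_mat (A * Q) * (A * Q) = transpose_mat Q * (transpose_mat A * A) * Q"
      using A Q AT by (simp add: transpose_mult[of _ n m _ m] assoc_mult_mat[of _ m m _ n _ m]
          assoc_mult_mat[of _ m n _ m _ m] assoc_mult_mat[of _ m m _ m _ m]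
          mult_carrier_mat[of _ n m _ m] mult_carrier_mat[of _ m n _ m])
    also have "\<dots> = real n \<cdot>\<^sub>m (transpose_mat Q * normal_mat A * Q)"
      unfolding AA using Q normal_mat_carrier[OF A]
      by (simp add: mult_smult_distrib[of _ m m _ m] mult_smult_assoc_mat[of _ m m _ m])
    also have "transpose_mat Q * normal_mat A * Q
        = (transpose_mat Q * Q) * mat_diag m d * (transpose_mat Q * Q)"
      unfolding BQ using Q(1) QT by (simp add: assoc)
    also have "\<dots> = mat_diag m d"
      unfolding Q(2) by (simp add: left_mult_one_mat[of _ m m] right_mult_one_mat[of _ m m])
    finally show ?thesis
      using l by (simp add: mat_diag_def)
  qed
  have row_c: "Matrix.row A i \<in> carrier_vec m" if "i < n" for i
    using A that by auto
  interpret gram_system n m b d c0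
  proof
    fix i assume i: "i < n"
    have "(\<Sum>l<m. (b i l)\<^sup>2) = (vnorm (Matrix.row A i))\<^sup>2"
      using i by (simp add: vnorm_coord row_c row_coord)
    also have "\<dots> \<le> Max ((\<lambda>i. (vnorm (Matrix.row A i))\<^sup>2) ` {..<n})"
      using i by (intro Max_ge) auto
    finally have "c0 * (\<Sum>l<m. (b i l)\<^sup>2) \<le> c0 * Max ((\<lambda>i. (vnorm (Matrix.row A i))\<^sup>2) ` {..<n})"
      using c0 by (intro mult_left_mono) auto
    then show "c0 * (\<Sum>l<m. (b i l)\<^sup>2) \<le> 1"
      using rows by linarith
  qed (use n c0 gram in auto)
  define z where "z = coord (x1 - xdag)"
  have coord_minus: "coord (x - y) l = coord x l - coord y l"
    if "x \<in> carrier_vec m" "y \<in> carrier_vec m" "l < m" for x y l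
    using that QT by (simp add: coord_def mult_minus_distrib_mat_vec[OF QT] del: index_mult_mat_vec)
  have coord_smult: "coord (c \<cdot>\<^sub>v x) l = c * coord x l"
    if "x \<in> carrier_vec m" "l < m" for c x l
    using that QT by (simp add: coord_def mult_mat_vec[OF QT] del: index_mult_mat_vec)
  have iter_coord: "coord (sgd A (ydag + \<xi>) \<eta> x1 f (Suc k) - xdag) l = iter \<eta> (\<lambda>i. \<xi> $ i) z f k l"
    if "\<And>j. j \<in> {1..k} \<Longrightarrow> f j < n" "l < m" for f k l
    using that
  proof (induction k arbitrary: l)
    case 0
    then show ?case
      by (simp add: z_def)
  next
    case (Suc k)
    let ?x = "sgd A (ydag + \<xi>) \<eta> x1 f (Suc k)" and ?i = "f (Suc k)"
    have x: "?x \<in> carrier_vec m"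
      using Suc.prems by (intro sgd_carrier[OF A x1]) auto
    have i: "?i < n"
      using Suc.prems by simp
    have IH: "coord (?x - xdag) l = iter \<eta> (\<lambda>i. \<xi> $ i) z f k l" if "l < m" for l
      using Suc.IH[OF _ that] Suc.prems(1) by simp
    define t where "t = scalar_prod (Matrix.row A ?i) ?x - (ydag + \<xi>) $ ?i"
    \<comment> \<open>Since A xdag = ydag, the residual is expressed by the error and the noise
      alone.\<close>
    have "(ydag + \<xi>) $ ?i = scalar_prod (Matrix.row A ?i) xdag + \<xi> $ ?i"
      unfolding xdag(2)[symmetric] using i A \<xi> by simp
    then have "t = scalar_prod (Matrix.row A ?i) (?x - xdag) - \<xi> $ ?i"
      using x xdag(1) row_c[OF i] by (simp add: t_def scalar_prod_minus_distrib[of _ m])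
    also have "scalar_prod (Matrix.row A ?i) (?x - xdag)
        = row_prod ?i (iter \<eta> (\<lambda>i. \<xi> $ i) z f k)"
      using x xdag(1) row_c[OF i] i by (simp add: prod_coord row_prod_def row_coord IH)
    finally have t: "t = row_prod ?i (iter \<eta> (\<lambda>i. \<xi> $ i) z f k) - \<xi> $ ?i" .
    have sgd_eq: "sgd A (ydag + \<xi>) \<eta> x1 f (Suc (Suc k)) - xdag
        = (?x - xdag) - (\<eta> (Suc k) * t) \<cdot>\<^sub>v Matrix.row A ?i"
      unfolding sgd.simps(3) Let_def t_def[symmetric]
      using x xdag(1) A by (intro eq_vecI) auto
    have "coord ((?x - xdag) - (\<eta> (Suc k) * t) \<cdot>\<^sub>v Matrix.row A ?i) l
        = coord (?x - xdag) l - \<eta> (Suc k) * t * coord (Matrix.row A ?i) l"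
      using x xdag(1) row_c[OF i] Suc.prems(2) by (subst coord_minus) (simp_all add: coord_smult)
    then show ?case
      unfolding sgd_eq by (simp add: IH Suc.prems(2) row_coord i sgd_step_def t)
  qed
  let ?G = "\<lambda>f. \<Sum>l<m. (iter \<eta> (\<lambda>i. \<xi> $ i) z f k l)\<^sup>2"
  let ?V = "path_mean n k (\<lambda>f. \<Sum>l<m. (iter \<eta> (\<lambda>i. \<xi> $ i) (\<lambda>_. 0) f k l)\<^sup>2)"
  have "prob_space.expectation M
      (\<lambda>\<omega>. (vnorm (sgd A (ydag + \<xi>) \<eta> x1 (\<lambda>j. X j \<omega>) (k + 1) - xdag))\<^sup>2)
      = path_mean n k (\<lambda>f. (vnorm (sgd A (ydag + \<xi>) \<eta> x1 f (k + 1) - xdag))\<^sup>2)"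
  proof (rule expectation_eq_path_mean[OF iid n])
    fix f g :: "nat \<Rightarrow> nat"
    assume "\<And>j. j \<in> {1..k} \<Longrightarrow> f j = g j"
    then have "sgd A (ydag + \<xi>) \<eta> x1 f (Suc k) = sgd A (ydag + \<xi>) \<eta> x1 g (Suc k)"
      by (rule sgd_cong)
    then show "(vnorm (sgd A (ydag + \<xi>) \<eta> x1 f (k + 1) - xdag))\<^sup>2
        = (vnorm (sgd A (ydag + \<xi>) \<eta> x1 g (k + 1) - xdag))\<^sup>2"
      by simp
  qed
  also have "\<dots> \<le> path_mean n k ?G"
  proof (rule path_mean_mono)
    fix f :: "nat \<Rightarrow> nat"
    assume f: "\<And>j. j \<in> {1..k} \<Longrightarrow> f j < n"
    have "sgd A (ydag + \<xi>) \<eta> x1 f (Suc k) - xdag \<in> carrier_vec m"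
      using sgd_carrier[OF A x1 f] xdag(1) by simp
    then show "(vnorm (sgd A (ydag + \<xi>) \<eta> x1 f (k + 1) - xdag))\<^sup>2 \<le> ?G f"
      using iter_coord[OF f] by (simp add: vnorm_coord del: sgd.simps)
  qed
  also have "\<dots> \<le> 2 * energy \<eta> z k + 2 * ?V"
    by (rule iter_energy_le)
  also have "\<dots> \<le> 2 * (rate_const p ((vnorm w)\<^sup>2) ((spectral_norm A)\<^sup>2) c0
        * real k powr (- min (2 * \<alpha>) (min 1 (2 * p) * (1 - \<alpha>))) * (ln (real k))\<^sup>2)
      + 2 * (c0 * (real k powr (1 - \<alpha>) / (1 - \<alpha>)) * (vnorm \<xi> / sqrt (real n))\<^sup>2)"
  proof (intro add_mono mult_left_mono)
    show "energy \<eta> z k \<le> rate_const p ((vnorm w)\<^sup>2) ((spectral_norm A)\<^sup>2) c0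
        * real k powr (- min (2 * \<alpha>) (min 1 (2 * p) * (1 - \<alpha>))) * (ln (real k))\<^sup>2"
    proof (rule energy_rate[OF \<alpha> p _ \<eta> _ _ _ k])
      fix l assume l: "l < m"
      have q: "Matrix.col Q l \<in> carrier_vec m"
        using Q l by auto
      \<comment> \<open>Column \<open>l\<close> of \<open>Q\<close> is a unit eigenvector q_l, so |A
        q_l|^2 = n d_l is at most |A|^2.\<close>
      have "scalar_prod (Matrix.col Q l) (Matrix.col Q l) = (transpose_mat Q * Q) $$ (l, l)"
        using Q(1) l by simp
      then have "vnorm (Matrix.col Q l) = 1"
        using l by (simp add: Q(2) vnorm_def)
      then have "vnorm (A *\<^sub>v Matrix.col Q l) \<le> spectral_norm A"
        by (intro vnorm_mult_le_spectral_norm[OF A q]) simp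
      then have "(vnorm (A *\<^sub>v Matrix.col Q l))\<^sup>2 \<le> (spectral_norm A)\<^sup>2"
        by (intro power_mono vnorm_nonneg)
      also have "(vnorm (A *\<^sub>v Matrix.col Q l))\<^sup>2 = (\<Sum>i<n. b i l * b i l)"
        unfolding vnorm_sq using A Q(1) l by (simp add: b_def power2_eq_square)
      finally show "real n * d l \<le> (spectral_norm A)\<^sup>2"
        using gram[OF l l] by simp
    next
      fix l assume l: "l < m"
      have D: "mat_diag m (\<lambda>i. rpow (d i) p) \<in> carrier_mat m m"
        by simp
      have Qw: "transpose_mat Q *\<^sub>v w \<in> carrier_vec m"
        using QT w by simp
      \<comment> \<open>Multiplication by Q^T makes the source condition diagonal.\<close>
      have "transpose_mat Q *\<^sub>v (xdag - x1)
          = transpose_mat Q *\<^sub>v (Q * mat_diag m (\<lambda>i. rpow (d i) p) * transpose_mat Q *\<^sub>v w)"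
        unfolding source mat_fpow_eq[OF Q BQ] ..
      also have "\<dots> = (transpose_mat Q * Q)
          *\<^sub>v (mat_diag m (\<lambda>i. rpow (d i) p) *\<^sub>v (transpose_mat Q *\<^sub>v w))"
        using Q(1) QT D w Qw by (simp add: assoc_mult_mat_vec[of _ m m _ m]
            mult_carrier_mat[of _ m m _ m] mult_mat_vec_carrier[of _ m m])
      also have "\<dots> = mat_diag m (\<lambda>i. rpow (d i) p) *\<^sub>v (transpose_mat Q *\<^sub>v w)"
        unfolding Q(2) using mult_mat_vec_carrier[OF D Qw] by simp
      finally have "coord (xdag - x1) l
          = (mat_diag m (\<lambda>i. rpow (d i) p) *\<^sub>v (transpose_mat Q *\<^sub>v w)) $ l"
        by (simp only: coord_def)
      also have "\<dots> = (\<Sum>j<m. if j = l then rpow (d l) p * coord w l else 0)"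
        unfolding mult_mat_vec_index[OF D Qw l] using l
        by (intro sum.cong refl) (auto simp: mat_diag_def coord_def)
      finally have "coord (xdag - x1) l = rpow (d l) p * coord w l"
        using l by simp
      then have "z l = - (rpow (d l) p * coord w l)"
        using l x1 xdag(1) by (simp add: z_def coord_minus)
      then show "(z l)\<^sup>2 = (rpow (d l) p * coord w l)\<^sup>2"
        by simp
    qed (use w vnorm_coord in auto)
    have \<eta>b: "0 \<le> \<eta> j \<and> \<eta> j \<le> c0" if "1 \<le> j" for j
      using \<eta>[OF that] that c0 \<alpha> powr_mono[of "- \<alpha>" 0 "real j"] by (auto simp: mult_left_le)
    have "?V \<le> (\<Sum>j\<in>{1..k}. \<eta> j) * ((\<Sum>i<n. (\<xi> $ i)\<^sup>2) / real n)"
      by (rule noise_energy_le[OF \<eta>b])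
    also have "(\<Sum>i<n. (\<xi> $ i)\<^sup>2) / real n = (vnorm \<xi> / sqrt (real n))\<^sup>2"
      using \<xi> by (simp add: vnorm_sq power_divide)
    also have "(\<Sum>j\<in>{1..k}. \<eta> j) * (vnorm \<xi> / sqrt (real n))\<^sup>2
        \<le> c0 * (real k powr (1 - \<alpha>) / (1 - \<alpha>)) * (vnorm \<xi> / sqrt (real n))\<^sup>2"
    proof (rule mult_right_mono)
      have "(\<Sum>j\<in>{1..k}. \<eta> j) = c0 * (\<Sum>j\<in>{1..k}. real j powr (- \<alpha>))"
        by (simp add: \<eta> sum_distrib_left)
      also have "\<dots> \<le> c0 * (real k powr (1 - \<alpha>) / (1 - \<alpha>))"
        using c0 by (intro mult_left_mono sum_powr_minus_le \<alpha>) auto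
      finally show "(\<Sum>j\<in>{1..k}. \<eta> j) \<le> c0 * (real k powr (1 - \<alpha>) / (1 - \<alpha>))" .
    qed simp
    finally show "?V \<le> c0 * (real k powr (1 - \<alpha>) / (1 - \<alpha>)) * (vnorm \<xi> / sqrt (real n))\<^sup>2" .
  qed auto
  finally show ?thesis
    by (simp add: mult_ac)
qed

theorem theorem2p2:
  shows "\<exists>c c' c'' :: real \<Rightarrow> real \<Rightarrow> real \<Rightarrow> real \<Rightarrow> real \<Rightarrow> real \<Rightarrow> real.
    \<forall>(n::nat) (m::nat) (A :: real Matrix.mat) (x1 :: real Matrix.vec) (ydag :: real Matrix.vec)
     (xdag :: real Matrix.vec) (\<xi> :: real Matrix.vec) (ydelta :: real Matrix.vec)
     (\<delta>::real) (\<delta>bar::real) (c0::real) (\<alpha>::real) (\<eta> :: nat \<Rightarrow> real) (p::real)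
     (w :: real Matrix.vec) (M :: 'a measure) (I :: nat \<Rightarrow> 'a \<Rightarrow> nat) (k::nat).
      0 < n \<and> A \<in> carrier_mat n m \<and> x1 \<in> carrier_vec m \<and>
      ydag \<in> (\<lambda>x. A *\<^sub>v x) ` carrier_vec m \<and>
      min_norm_solution A ydag x1 xdag \<and>
      \<xi> \<in> carrier_vec n \<and> ydelta = ydag + \<xi> \<and>
      \<delta> = vnorm \<xi> \<and> \<delta>bar = \<delta> / sqrt (real n) \<and>
      iid_uniform M n I \<and>
      0 < \<alpha> \<and> \<alpha> < 1 \<and> 0 < c0 \<and>
      c0 * Max ((\<lambda>i. (vnorm (Matrix.row A i))\<^sup>2) ` {..<n}) \<le> 1 \<and>
      (\<forall>j\<ge>1. \<eta> j = c0 * real j powr (- \<alpha>)) \<and>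
      0 \<le> p \<and> w \<in> carrier_vec m \<and> xdag - x1 = mat_fpow (normal_mat A) p *\<^sub>v w \<and>
      2 \<le> k
      \<longrightarrow>
      prob_space.expectation M
        (\<lambda>\<omega>. (vnorm (sgd A ydelta \<eta> x1 (\<lambda>j. I j \<omega>) (k + 1) - xdag))\<^sup>2)
      \<le> c \<alpha> p (vnorm w) (vnorm (A *\<^sub>v x1 - ydelta)) (spectral_norm A) c0
            * real k powr (- min (2 * \<alpha>) (min 1 (2 * p) * (1 - \<alpha>))) * (ln (real k))\<^sup>2
        + c' \<alpha> p (vnorm w) (vnorm (A *\<^sub>v x1 - ydelta)) (spectral_norm A) c0
            * real k powr (1 - \<alpha>) * \<delta>bar\<^sup>2
        + c'' \<alpha> p (vnorm w) (vnorm (A *\<^sub>v x1 - ydelta)) (spectral_norm A) c0 * \<delta>\<^sup>2"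
proof -
  \<comment> \<open>A constrained minimizer satisfies the constraints.\<close>
  have *: "xdag \<in> carrier_vec m \<and> A *\<^sub>v xdag = ydag"
    if "min_norm_solution A ydag x1 xdag" "A \<in> carrier_mat n m" for A ydag x1 xdag n m
    using that by (auto simp: min_norm_solution_def is_arg_min_def)
  show ?thesis
  \<comment> \<open>\<open>rate_const\<close> takes squared norms, hence the squares. The second
    constant is twice the factor in the bound on the sum of the step sizes; the third is 0 since the
    second term already covers the noise.\<close>
  proof (rule exI[of _ "\<lambda>\<alpha> p \<omega> r a c0. 2 * rate_const p (\<omega>\<^sup>2) (a\<^sup>2) c0"],
      rule exI[of _ "\<lambda>\<alpha> p \<omega> r a c0. 2 * c0 / (1 - \<alpha>)"], rule exI[of _ "\<lambda>\<alpha> p \<omega> r a c0. 0"],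
      intro allI impI, elim conjE, goal_cases)
    case (1 n m A x1 ydag xdag \<xi> ydelta \<delta> \<delta>bar c0 \<alpha> \<eta> p w M I k)
    then show ?case
      using sgd_error_bound[of n A m x1 xdag ydag \<xi> M I \<alpha> c0 \<eta> p w k] *[of A ydag x1 xdag n m]
      by simp
  qed
qed

end
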